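(* Let $\delta$ be an ordinal and let $\langle\Phi_\alpha:\alpha\le\delta\rangle$ be a Scott process with nonempty levels such that $\Phi_\delta$ is countable. Then $\langle\Phi_\alpha:\alpha\le\delta\rangle$ has a countable model; that is, there is a countable $\tau$-structure $M$ with $\Phi_\alpha(M)=\Phi_\alpha$ for all $\alpha\le\delta$.
   Context: Conventions. $\tau$ is a fixed relational vocabulary containing a $0$-ary relation symbol and $=$ (interpreted as equality); $x_0,x_1,\dots$ are distinct variables; conjunctions and disjunctions in $\mathcal{L}_{\infty,\omega}(\tau)$ are over unordered sets. $X_n=\{x_m:m<n\}$, $i_n$ is the identity function on $X_n$, and $\mathcal I_{m,n}$ ($m\le n$) is the set of injections from $X_m$ to $X_n$ ($i_m$ is also regarded as the inclusion, a member of $\mathcal I_{m,n}$). Formulas. By recursion on $\alpha$ define $\Psi^n_\alpha$ ($n\in\omega$) and $\Psi_\alpha=\bigcup_n\Psi^n_\alpha$. $\Psi^n_0$ is the set of all conjunctions consisting of, for each atomic $\tau$-formula with variables from $X_n$, either the formula or its negation, including $x_i\ne x_j$ for all distinct $x_i,x_j\in X_n$. $\Psi^n_{\alpha+1}$ is the set of all $\phi$ of the form $\phi'\wedge\bigwedge_{\psi\in E}\exists x_n\psi\wedge\forall x_n(x_n\notin\{x_0,\dots,x_{n-1}\}\to\bigvee_{\psi\in E}\psi)$ with $\phi'\in\Psi^n_\alpha$ and $E\subseteq\Psi^{n+1}_\alpha$; write $V_{\alpha,\alpha+1}(\phi)=\phi'$ and $E(\phi)=E$. For limit $\alpha$, $\Psi^n_\alpha$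 is the set of conjunctions $\bigwedge_{\beta<\alpha}\psi_\beta$ with $\psi_\beta\in\Psi^n_\beta$, $V_{\beta,\beta+1}(\psi_{\beta+1})=\psi_\beta$ for all $\beta<\alpha$, and $\psi_\beta=\bigwedge_{\gamma<\beta}\psi_\gamma$ for limit $\beta<\alpha$. Vertical projections $V_{\alpha,\beta}:\Psi_\beta\to\Psi_\alpha$ ($\alpha\le\beta$): $V_{\alpha,\alpha}$ is the identity; $V_{\alpha,\alpha+1}$ sends each $\phi\in\Psi^n_{\alpha+1}$ to its first conjunct $\phi'\in\Psi^n_\alpha$; for limit $\beta>\alpha$, $V_{\alpha,\beta}(\phi)$ is the unique conjunct of $\phi$ in $\Psi_\alpha$; $V_{\alpha,\beta+1}=V_{\alpha,\beta}\circ V_{\beta,\beta+1}$ for $\alpha<\beta$. Horizontal projections: for $\phi\in\Psi^n_\alpha$, $m\le n$, $j\in\mathcal I_{m,n}$, define $H^n_\alpha(\phi,j)\in\Psi^m_\alpha$: $H^n_0(\phi,j)$ is the conjunction of the conjuncts of $\phi$ whose variables lie in $\mathrm{range}(j)$, with variables replaced by their $j$-preimages; $H^n_{\alpha+1}(\phi,j)$ is the $\psi\in\Psi^m_{\alpha+1}$ with $V_{\alpha,\alpha+1}(\psi)=H^n_\alpha(V_{\alpha,\alpha+1}(\phi),j)$ and $E(\psi)=\{H^{n+1}_\alpha(\theta,j\cup\{(x_m,y)\}):\theta\in E(\phi),\,y\in X_{n+1}\setminus\mathrm{range}(j)\}$; for limit $\alpha$, $H^n_\alpha(\phi,j)=\bigwedge_{\beta<\alpha}H^n_\beta(V_{\beta,\alpha}(\phi),j)$.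 Scott processes. A Scott process of length $\delta$ is a sequence $\langle\Phi_\alpha:\alpha<\delta\rangle$ such that, writing $\Phi^n_\alpha=\Phi_\alpha\cap\Psi^n_\alpha$: (1a) $\Phi_\alpha\subseteq\Psi_\alpha$; (1b) $E(\phi)\subseteq\Phi_\alpha$ whenever $\alpha+1<\delta$, $\phi\in\Phi_{\alpha+1}$; (1c) $\Phi_\alpha=V_{\alpha,\beta}[\Phi_\beta]$ for $\alpha<\beta<\delta$; (1d) $H^n_\alpha(\phi,j)\in\Phi^n_\alpha$ for $\phi\in\Phi^n_\alpha$, $j\in\mathcal I_{n,n}$; (1e) $\Phi^m_\alpha=H^n_\alpha[\Phi^n_\alpha\times\{i_m\}]$ for $m<n$; (2a) for $\alpha+1<\delta$, $\phi\in\Phi^n_{\alpha+1}$: $E(\phi)=V_{\alpha,\alpha+1}[\{\psi\in\Phi^{n+1}_{\alpha+1}:H^{n+1}_{\alpha+1}(\psi,i_n)=\phi\}]$; (2b) for $\alpha<\beta<\delta$, $\phi\in\Phi^n_\beta$: $E(V_{\alpha+1,\beta}(\phi))\subseteq V_{\alpha,\beta}[\{\psi\in\Phi^{n+1}_\beta:H^{n+1}_\beta(\psi,i_n)=\phi\}]$; (2c) for $\phi\in\Phi^n_\alpha$, $\psi\in\Phi^m_\alpha$ there are $\theta\in\Phi^{n+m}_\alpha$ and $j\in\mathcal I_{m,n+m}$ with $\phi=H^{n+m}_\alpha(\theta,i_n)$ and $\psi=H^{n+m}_\alpha(\theta,j)$. The sets $\Phi_\alpha$ are the levels of the process. Scott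 process of a structure. For a $\tau$-structure $M$ and a tuple $\bar a$ of $n$ distinct elements of $M$: $\phi^M_{\bar a,0}$ is the conjunction of all atomic and negated atomic formulas in variables $X_n$ satisfied by $\bar a$ in $M$; $\phi^M_{\bar a,\alpha+1}$ is the $\phi\in\Psi^n_{\alpha+1}$ with $V_{\alpha,\alpha+1}(\phi)=\phi^M_{\bar a,\alpha}$ and $E(\phi)=\{\phi^M_{\bar a^\frown\langle c\rangle,\alpha}:c\in M\text{ not in }\bar a\}$; $\phi^M_{\bar a,\beta}=\bigwedge_{\alpha<\beta}\phi^M_{\bar a,\alpha}$ for limit $\beta$. $\Phi_\alpha(M)$ is the set of all $\phi^M_{\bar a,\alpha}$, $\bar a$ a finite tuple of distinct elements of $M$.
   Formalization: The formulas in Ψ^n_0 are additionally required to contain x_i = x_i for every x_i in X_n; if the negation x_i ≠ x_i were allowed, a process containing it could have no model and the claim would fail already for δ = 0. *)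

theory Defs
  imports "HOL-Library.FuncSet" "HOL-Library.Countable_Set"
begin

section \<open>Infinitary formulas\<close>

text \<open>
  Variables are represented by their indices. A vocabulary is a type \<open>'r\<close> of relation symbols
  with an arity function; equality is a logical symbol and not counted among them.
\<close>

datatype 'r atom = Rel 'r "nat list" | Eq nat nat

fun atom_vars :: "'r atom \<Rightarrow> nat set" where
  "atom_vars (Rel r is) = set is"
| "atom_vars (Eq i k) = {i, k}"

fun rename_atom :: "(nat \<Rightarrow> nat) \<Rightarrow> 'r atom \<Rightarrow> 'r atom" where
  "rename_atom f (Rel r is) = Rel r (map f is)"
| "rename_atom f (Eq i k) = Eq (f i) (f k)"

text \<open>
  No HOL type contains formulas with conjunctions of every size. The type \<open>('r, 'k) fm\<close> below
  consists of the formulas of the infinitary logic in which conjunctions and disjunctions are taken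
  over sets of at most \<open>|'k| + \<aleph>\<^sub>0\<close> formulas; \<open>'k\<close> stays arbitrary throughout. Since
  conjunctions are over unordered sets, \<open>fm\<close> is the quotient of a type of well-founded trees
  (whose conjunctions are families indexed by \<open>'k + nat\<close>) by hereditary equality of the sets of
  members.
\<close>

datatype ('r, 'k) tree =
    TAtom "'r atom"
  | TNeg "('r, 'k) tree"
  | TImp "('r, 'k) tree" "('r, 'k) tree"
  | TEx nat "('r, 'k) tree"
  | TAll nat "('r, 'k) tree"
  | TConj "'k + nat \<Rightarrow> ('r, 'k) tree option"
  | TDisj "'k + nat \<Rightarrow> ('r, 'k) tree option"

inductive tree_eq :: "('r, 'k) tree \<Rightarrow> ('r, 'k) tree \<Rightarrow> bool" where
  "tree_eq (TAtom a) (TAtom a)"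
| "tree_eq s t \<Longrightarrow> tree_eq (TNeg s) (TNeg t)"
| "tree_eq s t \<Longrightarrow> tree_eq s' t' \<Longrightarrow> tree_eq (TImp s s') (TImp t t')"
| "tree_eq s t \<Longrightarrow> tree_eq (TEx i s) (TEx i t)"
| "tree_eq s t \<Longrightarrow> tree_eq (TAll i s) (TAll i t)"
| "rel_set tree_eq (ran f) (ran g) \<Longrightarrow> tree_eq (TConj f) (TConj g)"
| "rel_set tree_eq (ran f) (ran g) \<Longrightarrow> tree_eq (TDisj f) (TDisj g)"
monos rel_set_mono

inductive_simps tree_eq_simps:
  "tree_eq (TAtom a) t" "tree_eq (TNeg s) t" "tree_eq (TImp s s') t" "tree_eq (TEx i s) t"
  "tree_eq (TAll i s) t" "tree_eq (TConj f) t" "tree_eq (TDisj f) t"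

lemma tree_eq_refl: "tree_eq t t"
proof (induction t)
  case (TConj f)
  then have "tree_eq x x" if "x \<in> ran f" for x
    using that by (fastforce simp: ran_def intro: rangeI[of f])
  then show ?case by (intro tree_eq.intros) (auto simp: rel_set_def)
next
  case (TDisj f)
  then have "tree_eq x x" if "x \<in> ran f" for x
    using that by (fastforce simp: ran_def intro: rangeI[of f])
  then show ?case by (intro tree_eq.intros) (auto simp: rel_set_def)
qed (auto intro: tree_eq.intros)

lemma tree_eq_sym: "tree_eq s t \<Longrightarrow> tree_eq t s"
proof (induction rule: tree_eq.induct)
  case (6 f g)
  then show ?case by (intro tree_eq.intros) (auto simp: rel_set_def)
next
  case (7 f g)
  then show ?case by (intro tree_eq.intros) (auto simp: rel_set_def)
qed (auto intro: tree_eq.intros)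

lemma tree_eq_trans: "tree_eq s t \<Longrightarrow> tree_eq t u \<Longrightarrow> tree_eq s u"
proof (induction arbitrary: u rule: tree_eq.induct)
  case (6 f g)
  then obtain h where u: "u = TConj h" "rel_set tree_eq (ran g) (ran h)"
    by (auto simp: tree_eq_simps)
  have "rel_set tree_eq (ran f) (ran h)"
    using 6(1) u(2) unfolding rel_set_def by meson
  then show ?case unfolding u by (rule tree_eq.intros)
next
  case (7 f g)
  then obtain h where u: "u = TDisj h" "rel_set tree_eq (ran g) (ran h)"
    by (auto simp: tree_eq_simps)
  have "rel_set tree_eq (ran f) (ran h)"
    using 7(1) u(2) unfolding rel_set_def by meson
  then show ?case unfolding u by (rule tree_eq.intros)
qed (auto simp: tree_eq_simps)

quotient_type ('r, 'k) fm = "('r, 'k) tree" / tree_eq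
  by (intro equivpI reflpI sympI transpI) (auto intro: tree_eq_refl tree_eq_sym tree_eq_trans)

lift_definition Atom :: "'r atom \<Rightarrow> ('r, 'k) fm" is TAtom .
lift_definition Neg :: "('r, 'k) fm \<Rightarrow> ('r, 'k) fm" is TNeg by (rule tree_eq.intros)
lift_definition Imp :: "('r, 'k) fm \<Rightarrow> ('r, 'k) fm \<Rightarrow> ('r, 'k) fm" is TImp by (rule tree_eq.intros)
lift_definition Ex_fm :: "nat \<Rightarrow> ('r, 'k) fm \<Rightarrow> ('r, 'k) fm" is TEx by (rule tree_eq.intros)
lift_definition All_fm :: "nat \<Rightarrow> ('r, 'k) fm \<Rightarrow> ('r, 'k) fm" is TAll by (rule tree_eq.intros)

definition small :: "('r, 'k) fm set \<Rightarrow> bool" where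
  "small A \<longleftrightarrow> (\<exists>f :: 'k + nat \<Rightarrow> ('r, 'k) fm option. A = ran f)"

text \<open>\<open>Conj A\<close> and \<open>Disj A\<close> are meaningful for small \<open>A\<close> only.\<close>

definition Conj :: "('r, 'k) fm set \<Rightarrow> ('r, 'k) fm" where
  "Conj A = abs_fm (TConj (SOME f. ran f = rep_fm ` A))"

definition Disj :: "('r, 'k) fm set \<Rightarrow> ('r, 'k) fm" where
  "Disj A = abs_fm (TDisj (SOME f. ran f = rep_fm ` A))"


lemma rep_abs_eq: "tree_eq (rep_fm (abs_fm t)) t"
  by (metis Quotient3_fm Quotient3_def tree_eq_refl)

lemma rep_fm_eq_iff: "tree_eq (rep_fm a) (rep_fm b) \<longleftrightarrow> a = b"
  by (metis Quotient3_fm Quotient3_rel_rep)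

lemma ran_some_rep:
  assumes "small (A :: ('r, 'k) fm set)"
  shows "ran (SOME f :: 'k + nat \<Rightarrow> ('r, 'k) tree option. ran f = rep_fm ` A) = rep_fm ` A"
proof -
  from assms obtain f :: "'k + nat \<Rightarrow> ('r, 'k) fm option" where "A = ran f"
    by (auto simp: small_def)
  then have "ran (map_option rep_fm \<circ> f) = rep_fm ` A"
    by (auto simp: ran_def image_iff)
  then have "\<exists>f :: 'k + nat \<Rightarrow> ('r, 'k) tree option. ran f = rep_fm ` A" by blast
  then show ?thesis by (rule someI_ex)
qed

lemma rel_set_rep_fm: "rel_set tree_eq (rep_fm ` A) (rep_fm ` B) \<longleftrightarrow> A = B"
  by (auto simp: rel_set_def rep_fm_eq_iff)

lemma abs_fm_eq_iff: "abs_fm s = abs_fm t \<longleftrightarrow> tree_eq s t"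
  by (metis fm.abs_eq_iff)

lemma Conj_inject: "small A \<Longrightarrow> small B \<Longrightarrow> Conj A = Conj B \<longleftrightarrow> A = B"
  by (simp add: Conj_def abs_fm_eq_iff tree_eq_simps ran_some_rep rel_set_rep_fm)

lemma Disj_inject: "small A \<Longrightarrow> small B \<Longrightarrow> Disj A = Disj B \<longleftrightarrow> A = B"
  by (simp add: Disj_def abs_fm_eq_iff tree_eq_simps ran_some_rep rel_set_rep_fm)

lemma fm_inject:
  "Atom a = Atom b \<longleftrightarrow> a = b"
  "Neg p = Neg q \<longleftrightarrow> p = q"
  "Imp p p' = Imp q q' \<longleftrightarrow> p = q \<and> p' = q'"
  "Ex_fm i p = Ex_fm l q \<longleftrightarrow> i = l \<and> p = q"
  "All_fm i p = All_fm l q \<longleftrightarrow> i = l \<and> p = q"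
  by (transfer, auto simp: tree_eq_simps)+

lemma fm_distinct:
  "Atom a \<noteq> Neg p" "Atom a \<noteq> Imp p q" "Atom a \<noteq> Ex_fm i p" "Atom a \<noteq> All_fm i p"
  "Neg p' \<noteq> Imp p q" "Neg p' \<noteq> Ex_fm i p" "Neg p' \<noteq> All_fm i p"
  "Imp p' q' \<noteq> Ex_fm i p" "Imp p' q' \<noteq> All_fm i p" "Ex_fm l p' \<noteq> All_fm i p"
  by (transfer, auto simp: tree_eq_simps)+

lemma Conj_Disj_distinct:
  "Conj A \<noteq> Disj B"
  "Atom a \<noteq> Conj A" "Neg p \<noteq> Conj A" "Imp p q \<noteq> Conj A" "Ex_fm i p \<noteq> Conj A" "All_fm i p \<noteq> Conj A"
  "Atom a \<noteq> Disj A" "Neg p \<noteq> Disj A" "Imp p q \<noteq> Disj A" "Ex_fm i p \<noteq> Disj A" "All_fm i p \<noteq> Disj A"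
  unfolding Conj_def Disj_def
  by (auto simp: Atom_def Neg.abs_eq Neg_def Imp_def Ex_fm_def All_fm_def abs_fm_eq_iff tree_eq_simps)

lemma small_image: "small ((f :: 'k + nat \<Rightarrow> ('r, 'k) fm) ` I)"
  unfolding small_def
  by (intro exI[of _ "\<lambda>x. if x \<in> I then Some (f x) else None"]) (auto simp: ran_def)

lemma small_subset:
  assumes "small (B :: ('r, 'k) fm set)" "A \<subseteq> B"
  shows "small A"
proof -
  from assms obtain f :: "'k + nat \<Rightarrow> ('r, 'k) fm option" where f: "B = ran f"
    by (auto simp: small_def)
  have "A = ran (\<lambda>x. case f x of Some a \<Rightarrow> if a \<in> A then Some a else None | None \<Rightarrow> None)"
    (is "_ = ran ?g")
  proof (intro equalityI subsetI)
    fix a assume a: "a \<in> A"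
    with assms f obtain x where "f x = Some a" by (auto simp: ran_def)
    with a have "?g x = Some a" by simp
    then show "a \<in> ran ?g" by (rule ranI)
  next
    fix a assume "a \<in> ran ?g"
    then show "a \<in> A" by (auto simp: ran_def split: option.splits if_splits)
  qed
  then show ?thesis unfolding small_def by (intro exI[of _ ?g])
qed

lemma small_countable:
  assumes "countable (A :: ('r, 'k) fm set)"
  shows "small A"
proof -
  have "A \<subseteq> (\<lambda>x. from_nat_into A (case x of Inr i \<Rightarrow> i | _ \<Rightarrow> 0)) ` (UNIV :: ('k + nat) set)"
    (is "_ \<subseteq> ?F ` _")
  proof
    fix a assume "a \<in> A"
    with assms obtain i where "from_nat_into A i = a" by (metis from_nat_into_surj)
    then have "a = ?F (Inr i)" by simp
    then show "a \<in> ?F ` UNIV" by blast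
  qed
  then show ?thesis by (rule small_subset[OF small_image])
qed


section \<open>Ordinals\<close>

text \<open>
  Ordinals are the elements of an arbitrary well-ordered type \<open>'o\<close>. A given ordinal exists as
  an element of a sufficiently large such type; successors need not exist, so the successor is a
  relation.
\<close>

definition is_zero :: "'o::wellorder \<Rightarrow> bool" where
  "is_zero \<alpha> \<longleftrightarrow> (\<forall>\<beta>. \<alpha> \<le> \<beta>)"

definition is_succ :: "'o::wellorder \<Rightarrow> 'o \<Rightarrow> bool" where
  "is_succ \<alpha> \<beta> \<longleftrightarrow> \<alpha> < \<beta> \<and> (\<forall>\<gamma>. \<alpha> < \<gamma> \<longrightarrow> \<beta> \<le> \<gamma>)"

definition is_limit :: "'o::wellorder \<Rightarrow> bool" where
  "is_limit \<beta> \<longleftrightarrow> \<not> is_zero \<beta> \<and> (\<nexists>\<alpha>. is_succ \<alpha> \<beta>)"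

definition opred :: "'o::wellorder \<Rightarrow> 'o" where
  "opred \<beta> = (THE \<alpha>. is_succ \<alpha> \<beta>)"

lemma opred_eq:
  assumes "is_succ \<alpha> \<beta>"
  shows "opred \<beta> = \<alpha>"
  unfolding opred_def
proof (rule the_equality, rule assms)
  fix \<gamma> assume "is_succ \<gamma> \<beta>"
  with assms show "\<gamma> = \<alpha>"
    unfolding is_succ_def by (cases \<gamma> \<alpha> rule: linorder_cases) (auto dest: leD)
qed

lemma opred_less: "\<exists>\<alpha>. is_succ \<alpha> \<beta> \<Longrightarrow> opred \<beta> < \<beta>"
  by (elim exE) (simp add: opred_eq, simp add: is_succ_def)


section \<open>The formulas \<open>\<Psi>\<^sup>n\<^sub>\<alpha>\<close>\<close>

text \<open>
  Conjunctions indexed by the atomic formulas or by the ordinals below some \<open>\<alpha> :: 'o\<close> are always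
  small for this instance, and \<open>'k\<close> leaves room for sets \<open>E\<close> of any further size.
\<close>

type_synonym ('r, 'o, 'k) formula = "('r, 'r + 'o + 'k) fm"

definition atoms :: "('r \<Rightarrow> nat) \<Rightarrow> nat \<Rightarrow> 'r atom set" where
  "atoms ar n = {Rel r is | r is. length is = ar r \<and> set is \<subseteq> {..<n}} \<union> {Eq i k | i k. i < n \<and> k < n}"

definition diagram :: "('r \<Rightarrow> nat) \<Rightarrow> nat \<Rightarrow> 'r atom set \<Rightarrow> ('r, 'k) fm" where
  "diagram ar n S = Conj (Atom ` (atoms ar n \<inter> S) \<union> (Neg \<circ> Atom) ` (atoms ar n - S))"

definition succ_fm :: "nat \<Rightarrow> ('r, 'k) fm \<Rightarrow> ('r, 'k) fm set \<Rightarrow> ('r, 'k) fm" where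
  "succ_fm n \<phi>' E =
     Conj {\<phi>',
           Conj (Ex_fm n ` E),
           All_fm n (Imp (Conj {Neg (Atom (Eq n i)) | i. i < n}) (Disj E))}"

text \<open>
  \<open>Psi ar \<alpha> n \<phi>\<close> states \<open>\<phi> \<in> \<Psi>\<^sup>n\<^sub>\<alpha>\<close>. As \<open>=\<close> is interpreted as equality,
  the diagrams of level zero contain \<open>x\<^sub>i = x\<^sub>i\<close> as well as \<open>x\<^sub>i \<noteq> x\<^sub>k\<close> for distinct
  \<open>i, k\<close>. The successor condition in the limit rule is \<open>V\<^bsub>\<beta>,\<beta>+1\<^esub>(\<psi>\<^bsub>\<beta>+1\<^esub>) = \<psi>\<^sub>\<beta>\<close>,
  spelled out because \<open>V\<close> is defined only afterwards.
\<close>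

inductive Psi ::
  "('r \<Rightarrow> nat) \<Rightarrow> 'o::wellorder \<Rightarrow> nat \<Rightarrow> ('r, 'o, 'k) formula \<Rightarrow> bool" for ar where
  zero: "is_zero \<alpha> \<Longrightarrow> (\<forall>i<n. \<forall>k<n. Eq i k \<in> S \<longleftrightarrow> i = k) \<Longrightarrow> Psi ar \<alpha> n (diagram ar n S)"
| succ: "is_succ \<alpha> \<beta> \<Longrightarrow> Psi ar \<alpha> n \<phi>' \<Longrightarrow> small E \<Longrightarrow> (\<forall>\<theta>\<in>E. Psi ar \<alpha> (Suc n) \<theta>)
    \<Longrightarrow> Psi ar \<beta> n (succ_fm n \<phi>' E)"
| limit: "is_limit \<alpha> \<Longrightarrow> (\<forall>\<beta><\<alpha>. Psi ar \<beta> n (\<psi> \<beta>))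
    \<Longrightarrow> (\<forall>\<beta> \<gamma>. is_succ \<beta> \<gamma> \<and> \<gamma> < \<alpha> \<longrightarrow>
          (\<exists>E. small E \<and> (\<forall>\<theta>\<in>E. Psi ar \<beta> (Suc n) \<theta>) \<and> \<psi> \<gamma> = succ_fm n (\<psi> \<beta>) E))
    \<Longrightarrow> (\<forall>\<beta><\<alpha>. is_limit \<beta> \<longrightarrow> \<psi> \<beta> = Conj (\<psi> ` {..<\<beta>}))
    \<Longrightarrow> Psi ar \<alpha> n (Conj (\<psi> ` {..<\<alpha>}))"

definition conjuncts :: "('r, 'k) fm \<Rightarrow> ('r, 'k) fm set" where
  "conjuncts \<phi> = (THE A. small A \<and> \<phi> = Conj A)"

text \<open>For \<open>\<phi> \<in> \<Psi>\<^bsub>\<alpha>+1\<^esub>\<close>, \<open>first_conj ar \<phi>\<close> is \<open>\<phi>'\<close> and \<open>ext ar \<phi>\<close> is \<open>E(\<phi>)\<close>.\<close>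

definition first_conj :: "('r \<Rightarrow> nat) \<Rightarrow> ('r, 'o::wellorder, 'k) formula \<Rightarrow> ('r, 'o, 'k) formula" where
  "first_conj ar \<phi> = (THE \<phi>'. \<exists>(\<alpha>::'o) n E. Psi ar \<alpha> n \<phi>' \<and> small E \<and>
     (\<forall>\<theta>\<in>E. Psi ar \<alpha> (Suc n) \<theta>) \<and> \<phi> = succ_fm n \<phi>' E)"

definition ext :: "('r \<Rightarrow> nat) \<Rightarrow> ('r, 'o::wellorder, 'k) formula \<Rightarrow> ('r, 'o, 'k) formula set" where
  "ext ar \<phi> = (THE E. \<exists>(\<alpha>::'o) n \<phi>'. Psi ar \<alpha> n \<phi>' \<and> small E \<and>
     (\<forall>\<theta>\<in>E. Psi ar \<alpha> (Suc n) \<theta>) \<and> \<phi> = succ_fm n \<phi>' E)"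


text \<open>
  The rest of this section shows that the definite descriptions above denote, and that a formula lies
  in \<open>\<Psi>\<^sup>n\<^sub>\<alpha>\<close> for at most one \<open>n\<close> and \<open>\<alpha>\<close>. This needs a nullary relation symbol: without
  one, \<open>\<Psi>\<^sup>0\<^sub>0\<close> contains the empty conjunction, which is also the second conjunct of \<open>succ_fm n \<phi>' {}\<close>.
\<close>

unbundle cardinal_syntax


lemma small_range: "|I::'c set| \<le>o |UNIV :: ('k + nat) set| \<Longrightarrow> small (g ` I :: ('r,'k) fm set)"
proof (cases "I = {}")
  case True then show ?thesis by (simp add: small_countable)
next
  case False
  assume "|I| \<le>o |UNIV :: ('k + nat) set|"
  with False obtain h :: "'k + nat \<Rightarrow> 'c" where "I = h ` UNIV" using card_of_ordLeq2[of I UNIV] by metis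
  then have "g ` I = (\<lambda>x. g (h x)) ` UNIV" by auto
  then show ?thesis using small_image by metis
qed

lemma small_image': 
  assumes "small (E :: ('r,'k) fm set)"
  shows "small (f ` E :: ('r,'k) fm set)"
proof -
  from assms obtain g :: "'k+nat \<Rightarrow> ('r,'k) fm option" where E: "E = ran g" by (auto simp: small_def)
  have "f ` E \<subseteq> (\<lambda>x. f (the (g x))) ` UNIV" unfolding E ran_def by (auto simp: image_iff) (metis option.sel)
  then show ?thesis by (rule small_subset[OF small_image])
qed

lemma small_ordinals: "small ((f :: 'o \<Rightarrow> ('r, 'o, 'k) formula) ` I)"
proof (rule small_range)
  have "inj_on (\<lambda>x. Inl (Inr (Inl x)) :: ('r+'o+'k)+nat) I" by (auto simp: inj_on_def)
  then show "|I| \<le>o |UNIV :: (('r+'o+'k)+nat) set|" by (meson card_of_ordLeq subset_UNIV)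
qed

lemma card_atoms: "|UNIV :: 'r atom set| \<le>o |UNIV :: (('r+'o)+nat) set|"
proof -
  let ?U = "UNIV :: (('r+'o)+nat) set"
  let ?N = "UNIV :: (nat + nat list) set"
  have inf: "infinite ?U" by (simp add: finite_Plus_UNIV_iff)
  have "|?N| \<le>o |?U|"
  proof -
    have "|?N| \<le>o |UNIV :: nat set|" by (rule surj_imp_ordLeq[of _ from_nat]) (metis surj_from_nat subset_UNIV)
    also have "|UNIV :: nat set| \<le>o |?U|"  using infinite_iff_card_of_nat inf by blast
    finally show ?thesis .
  qed
  then have N: "|?N| \<le>o |?U|" .
  have 1: "|?U \<times> ?N| \<le>o |?U|"
    using card_of_Times_infinite[OF inf _ N] ordIso_imp_ordLeq by blast
  define f :: "'r atom \<Rightarrow> (('r+'o)+nat) \<times> (nat + nat list)" where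
    "f p = (case p of Rel r is \<Rightarrow> (Inl (Inl r), Inr is) | Eq i k \<Rightarrow> (Inr i, Inl k))" for p
  have "inj f" by (auto simp: inj_def f_def split: atom.splits)
  then have "|UNIV :: 'r atom set| \<le>o |?U \<times> ?N|" by (metis card_of_ordLeq subset_UNIV UNIV_Times_UNIV)
  from ordLeq_transitive[OF this 1] show ?thesis .
qed

lemma small_atoms: "small ((f :: 'r atom \<Rightarrow> ('r, 'r + 'o) fm) ` S)"
proof (rule small_range)
  show "|S| \<le>o |UNIV :: (('r+'o)+nat) set|"
    using card_of_mono1[OF subset_UNIV] card_atoms ordLeq_transitive by blast
qed

lemma small_Un:
  assumes "small A" "small (B :: ('r,'k) fm set)"
  shows "small (A \<union> B)"
proof -
  have sc: "|S| \<le>o |UNIV :: ('k + nat) set|" if "small (S :: ('r,'k) fm set)" for S :: "('r,'k) fm set"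
  proof -
    from that obtain g :: "'k + nat \<Rightarrow> ('r,'k) fm option" where S: "S = ran g" by (auto simp: small_def)
    have "S \<subseteq> (\<lambda>x. the (g x)) ` UNIV" unfolding S ran_def by (auto simp: image_iff) (metis option.sel)
    then show ?thesis by (rule surj_imp_ordLeq)
  qed
  have inf: "infinite (UNIV :: ('k + nat) set)" by (simp add: finite_Plus_UNIV_iff)
  have "|\<Union>X\<in>{A,B}. X| \<le>o |UNIV :: ('k + nat) set|"
  proof (rule card_of_UNION_ordLeq_infinite[OF inf])
    show "|{A, B}| \<le>o |UNIV :: ('k + nat) set|"
      by (rule ordLess_imp_ordLeq, rule finite_ordLess_infinite[OF card_of_Well_order card_of_Well_order]) (use inf in \<open>simp_all add: Field_card_of\<close>)
  qed (use assms sc in auto)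
  from small_range[OF this, of id] show ?thesis by simp
qed

lemma small_diagram: "small (Atom ` S \<union> (Neg \<circ> Atom) ` T :: ('r, 'o, 'k) formula set)"
  by (intro small_Un small_atoms)

lemma conjuncts_Conj: "small A \<Longrightarrow> conjuncts (Conj A) = A"
  unfolding conjuncts_def by (rule the_equality) (auto simp: Conj_inject)

lemma conjuncts_diagram: "conjuncts (diagram ar n S :: ('r, 'o, 'k) formula) = Atom ` (atoms ar n \<inter> S) \<union> (Neg \<circ> Atom) ` (atoms ar n - S)"
  unfolding diagram_def by (intro conjuncts_Conj small_diagram)

lemma conjuncts_succ: "small E \<Longrightarrow> conjuncts (succ_fm n \<phi> E) =  {\<phi>,
           Conj (Ex_fm n ` E),
           All_fm n (Imp (Conj {Neg (Atom (Eq n i)) | i. i < n}) (Disj E))}"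
  unfolding succ_fm_def by (intro conjuncts_Conj small_countable) simp

lemma conjuncts_limit: "conjuncts (Conj ((f::'o \<Rightarrow> ('r,'o,'k) formula) ` I)) = f ` I"
  by (intro conjuncts_Conj small_ordinals)

lemma diagram_ne:
  assumes "ar r = 0"
  shows "conjuncts (diagram ar n S :: ('r, 'o, 'k) formula) \<noteq> {}"
proof -
  have "Rel r [] \<in> atoms ar n" using assms by (auto simp: atoms_def)
  then show ?thesis unfolding conjuncts_diagram by blast
qed

lemma is_zero_unique: "is_zero a \<Longrightarrow> is_zero b \<Longrightarrow> a = b" unfolding is_zero_def by (meson antisym)

lemma is_limit_nonempty: "is_limit b \<Longrightarrow> {..<b} \<noteq> {}" unfolding is_limit_def is_zero_def by (auto simp: not_le)
lemma is_succ_pred_unique: "is_succ a b \<Longrightarrow> is_succ a' b \<Longrightarrow> a = a'" using opred_eq by metis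
lemma is_succ_unique: "is_succ a b \<Longrightarrow> is_succ a b' \<Longrightarrow> b = b'" unfolding is_succ_def by (simp add: order_antisym)


lemma ordinal_kinds: "is_zero \<alpha> \<Longrightarrow> \<not> is_succ \<gamma> \<alpha>" "is_zero \<alpha> \<Longrightarrow> \<not> is_limit \<alpha>" "is_limit \<alpha> \<Longrightarrow> \<not> is_succ \<gamma> \<alpha>"
  "is_succ \<gamma> \<alpha> \<Longrightarrow> \<not> is_zero \<alpha>"
  unfolding is_zero_def is_succ_def is_limit_def by (meson leD)+

lemmas fm_simps = fm_distinct fm_distinct[symmetric] Conj_Disj_distinct Conj_Disj_distinct[symmetric] fm_inject

lemma Psi_Conj: 
  assumes P: "Psi ar \<alpha> n (\<phi> :: ('r, 'o::wellorder, 'k) formula)"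
  shows "\<exists>A. \<phi> = Conj A"
  using P by cases (auto simp: diagram_def succ_fm_def)

lemma Psi_Conj_not_Ex: assumes ar: "ar r = 0" and P: "Psi ar \<alpha> n (\<phi> :: ('r, 'o::wellorder, 'k) formula)"
  shows "\<exists>A. small A \<and> \<phi> = Conj A \<and> (\<exists>x\<in>A. \<forall>i y. x \<noteq> Ex_fm i y)"
  using P
proof cases
  case (zero S)
  let ?A = "Atom ` (atoms ar n \<inter> S) \<union> (Neg \<circ> Atom) ` (atoms ar n - S) :: ('r, 'o, 'k) formula set"
  have "conjuncts \<phi> \<noteq> {}" using diagram_ne[where ar=ar and r=r, OF ar] zero by blast
  then have "?A \<noteq> {}" unfolding zero conjuncts_diagram .
  then obtain x where "x \<in> ?A" by blast
  then have "\<exists>x\<in>?A. \<forall>i y. x \<noteq> Ex_fm i y" by (intro bexI[of _ x]) (auto simp: fm_simps)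
  then show ?thesis unfolding zero diagram_def using small_diagram by blast
next
  case (succ \<alpha> \<phi>' E)
  then show ?thesis unfolding succ_fm_def 
    by (intro exI conjI refl small_countable bexI[of _ "All_fm n (Imp (Conj {Neg (Atom (Eq n i)) | i. i < n}) (Disj E))"]) (auto simp: fm_simps)
next
  case (limit \<psi>)
  from is_limit_nonempty[OF limit(2)] obtain b where b: "b < \<alpha>" by auto
  from Psi_Conj[of ar b n "\<psi> b"] limit(3) b obtain A where A: "\<psi> b = Conj A" by auto
  show ?thesis unfolding limit(1)
    by (intro exI[of _ "\<psi> ` {..<\<alpha>}"] conjI small_ordinals refl bexI[of _ "\<psi> b"] imageI) (use A b in \<open>simp_all add: fm_simps\<close>)
qed

lemma succ_fm_inject:
  assumes ar: "ar r = 0" and "Psi ar \<alpha> k (\<phi> :: ('r, 'o::wellorder, 'k) formula)" "Psi ar \<beta> l \<psi>" 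
    "small E" "small F" "succ_fm n \<phi> E = succ_fm m \<psi> F"
  shows "n = m \<and> \<phi> = \<psi> \<and> E = F"
proof -
  let ?a = "All_fm n (Imp (Conj {Neg (Atom (Eq n i)) | i. i < n}) (Disj E))"
  let ?b = "All_fm m (Imp (Conj {Neg (Atom (Eq m i)) | i. i < m}) (Disj F))"
  have eq: "{\<phi>, Conj (Ex_fm n ` E), ?a} = {\<psi>, Conj (Ex_fm m ` F), ?b}"
    using arg_cong[OF assms(6), of conjuncts] unfolding conjuncts_succ[OF assms(4)] conjuncts_succ[OF assms(5)] .
  from Psi_Conj_not_Ex[where ar=ar and r=r, OF ar assms(2)] obtain A where A: "small A" "\<phi> = Conj A" "(\<exists>x\<in>A. \<forall>i y. x \<noteq> Ex_fm i y)" by blast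
  from Psi_Conj_not_Ex[where ar=ar and r=r, OF ar assms(3)] obtain B where B: "small B" "\<psi> = Conj B" "(\<exists>x\<in>B. \<forall>i y. x \<noteq> Ex_fm i y)" by blast
  have "?a \<in> {\<psi>, Conj (Ex_fm m ` F), ?b}" unfolding eq[symmetric] by simp
  then have "?a = ?b" using B(2) by (simp add: fm_simps)
  then have 1: "n = m" "E = F" using assms by (auto simp: fm_inject Disj_inject)
  have s: "small (Ex_fm m ` F)" using assms(5) by (rule small_image')
  have n: "\<phi> \<noteq> Conj (Ex_fm m ` F)" "\<psi> \<noteq> Conj (Ex_fm m ` F)"
    using A(2,3) B(2,3) by (auto simp: Conj_inject A(1) B(1) s)
  have "\<phi> \<in> {\<psi>, Conj (Ex_fm m ` F), ?b}" unfolding eq[symmetric] by simp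
  then have "\<phi> = \<psi>" using n A(2) by (simp add: fm_simps)
  then show ?thesis using 1 by simp
qed

lemma Psi_zero_conjuncts:
  assumes "is_zero \<alpha>" "Psi ar \<alpha> n (\<phi> :: ('r, 'o::wellorder, 'k) formula)" "conjuncts \<phi> = C"
  shows "\<forall>x\<in>C. \<exists>p. x = Atom p \<or> x = Neg (Atom p)" "Atom (Eq i i) \<in> C \<longleftrightarrow> i < n"
proof -
  from assms(2,1) obtain S where S: "\<phi> = diagram ar n S" "\<forall>i<n. \<forall>k<n. Eq i k \<in> S \<longleftrightarrow> i = k"
    by cases (auto dest: ordinal_kinds)
  then have C: "C = Atom ` (atoms ar n \<inter> S) \<union> (Neg \<circ> Atom) ` (atoms ar n - S)" using assms(3) conjuncts_diagram by metis
  show "\<forall>x\<in>C. \<exists>p. x = Atom p \<or> x = Neg (Atom p)" unfolding C by auto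
  show "Atom (Eq i i) \<in> C \<longleftrightarrow> i < n" unfolding C using S(2) by (auto simp: fm_inject fm_distinct atoms_def)
qed
lemma Psi_kind:
  assumes ar: "ar r = 0" and "Psi ar \<alpha> n (\<phi> :: ('r, 'o::wellorder, 'k) formula)"
  shows "(is_zero \<alpha> \<longleftrightarrow> (\<exists>p. Atom p \<in> conjuncts \<phi> \<or> Neg (Atom p) \<in> conjuncts \<phi>)) \<and> 
     ((\<exists>\<gamma>. is_succ \<gamma> \<alpha>) \<longleftrightarrow> (\<exists>i y. All_fm i y \<in> conjuncts \<phi>))"
  using assms(2)
proof cases
  case (zero S)
  have "conjuncts \<phi> \<noteq> {}" using diagram_ne[where ar=ar and r=r, OF ar] zero by blast
  then show ?thesis using zero(2) ordinal_kinds(1)[OF zero(2)] unfolding zero(1) conjuncts_diagram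
    by (auto simp: fm_simps)
next
  case (succ \<alpha>' \<phi>' E)
  from Psi_Conj[OF succ(3)] obtain A where A: "\<phi>' = Conj A" by blast
  show ?thesis unfolding succ(1) conjuncts_succ[OF succ(4)] using ordinal_kinds(4)[OF succ(2)] succ(2)
    by (auto simp: A fm_simps)
next
  case (limit \<psi>)
  have "\<exists>A. \<psi> b = Conj A" if "b < \<alpha>" for b using limit(3) that Psi_Conj by blast
  then obtain h where h: "\<psi> b = Conj (h b)" if "b < \<alpha>" for b by metis
  have "\<psi> ` {..<\<alpha>} = (\<lambda>b. Conj (h b)) ` {..<\<alpha>}" using h by auto
  then have c: "conjuncts \<phi> = (\<lambda>b. Conj (h b)) ` {..<\<alpha>}" unfolding limit(1) conjuncts_limit by simp
  show ?thesis unfolding c using limit(2) ordinal_kinds(2)[of \<alpha>] ordinal_kinds(3)[of \<alpha>] by (auto simp: fm_simps)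
qed

lemma Psi_unique:
  assumes ar: "ar r = 0"
  shows "Psi ar \<alpha> n (\<phi> :: ('r, 'o::wellorder, 'k) formula) \<Longrightarrow> Psi ar \<beta> m \<phi> \<Longrightarrow> \<alpha> = \<beta> \<and> n = m"
proof (induction "\<alpha>" arbitrary: n m \<phi> \<beta> rule: less_induct)
  case (less \<alpha>)
  note k = Psi_kind[where ar=ar and r=r, OF ar less(2)] Psi_kind[where ar=ar and r=r, OF ar less(3)]
  consider "is_zero \<alpha>" "is_zero \<beta>" | \<alpha>' \<beta>' where "is_succ \<alpha>' \<alpha>" "is_succ \<beta>' \<beta>" | "is_limit \<alpha>" "is_limit \<beta>"
    using k unfolding is_limit_def by metis
  then show ?case
  proof cases
    case 1
    then show ?thesis using Psi_zero_conjuncts(2)[OF 1(1) less(2) refl] Psi_zero_conjuncts(2)[OF 1(2) less(3) refl] is_zero_unique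
      by (metis linorder_neqE_nat less_irrefl)
  next
    case 2
    from less(2) obtain f E where f: "Psi ar \<alpha>' n f" "small E" "\<phi> = succ_fm n f E"
    proof cases
      case (succ a p F) then show ?thesis using that is_succ_pred_unique[OF succ(2) 2(1)] by auto
    qed (use 2 ordinal_kinds in blast)+
    from less(3) obtain g F where g: "Psi ar \<beta>' m g" "small F" "\<phi> = succ_fm m g F"
    proof cases
      case (succ a p F) then show ?thesis using that is_succ_pred_unique[OF succ(2) 2(2)] by auto
    qed (use 2 ordinal_kinds in blast)+
    have *: "succ_fm n f E = succ_fm m g F" using f g by simp
    from succ_fm_inject[where ar=ar and r=r, OF ar f(1) g(1) f(2) g(2) *] have "n = m" "f = g" by auto
    have "\<alpha>' < \<alpha>" using 2 by (simp add: is_succ_def)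
    from less(1)[OF this f(1), of \<beta>' m] g(1) \<open>f = g\<close> have "\<alpha>' = \<beta>'" by simp
    then show ?thesis using 2 \<open>n = m\<close> is_succ_unique[of \<alpha>' \<alpha> \<beta>] by simp
  next
    case 3
    from less(2) obtain f where f: "\<phi> = Conj (f ` {..<\<alpha>})" "\<forall>b<\<alpha>. Psi ar b n (f b)"
    proof cases
      case (limit \<psi>) then show ?thesis using that by blast
    qed (use 3 ordinal_kinds in blast)+
    from less(3) obtain g where g: "\<phi> = Conj (g ` {..<\<beta>})" "\<forall>b<\<beta>. Psi ar b m (g b)"
    proof cases
      case (limit \<psi>) then show ?thesis using that by blast
    qed (use 3 ordinal_kinds in blast)+
    have "conjuncts \<phi> = f ` {..<\<alpha>}" unfolding f(1) by (rule conjuncts_limit)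
    moreover have "conjuncts \<phi> = g ` {..<\<beta>}" unfolding g(1) by (rule conjuncts_limit)
    ultimately have eq: "f ` {..<\<alpha>} = g ` {..<\<beta>}" by (rule trans[OF sym])
    have *: "b < \<beta> \<and> n = m" if "b < \<alpha>" for b
    proof -
      from eq that have "f b \<in> g ` {..<\<beta>}" by blast
      then obtain c where c: "c < \<beta>" "f b = g c" by auto
      have "Psi ar b n (f b)" "Psi ar c m (f b)" using f(2) g(2) c that by auto
      from less(1)[OF that this] c show ?thesis by simp
    qed
    have **: "c < \<alpha>" if "c < \<beta>" for c
    proof -
      from eq that have "g c \<in> f ` {..<\<alpha>}" by blast
      then obtain b where c: "b < \<alpha>" "f b = g c" by auto
      have "Psi ar b n (f b)" "Psi ar c m (f b)" using f(2) g(2) c that by auto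
      from less(1)[OF c(1) this] c show ?thesis by simp
    qed
    have "\<alpha> = \<beta>" using * ** by (cases \<alpha> \<beta> rule: linorder_cases) blast+
    moreover from is_limit_nonempty[OF 3(1)] obtain b where "b < \<alpha>" by auto
    ultimately show ?thesis using * by blast
  qed
qed

lemma first_conj_ext:
  assumes ar: "ar r = 0" and P: "Psi ar \<alpha> n (\<phi>' :: ('r, 'o::wellorder, 'k) formula)" "small E"  "\<forall>\<theta>\<in>E. Psi ar \<alpha> (Suc n) \<theta>"
  shows "first_conj ar (succ_fm n \<phi>' E) = \<phi>'" "ext ar (succ_fm n \<phi>' E) = E"
  unfolding first_conj_def ext_def 
proof (rule_tac[!] the_equality)
  show "\<exists>(\<alpha>::'o) k F. Psi ar \<alpha> k \<phi>' \<and> small F \<and> (\<forall>\<theta>\<in>F. Psi ar \<alpha> (Suc k) \<theta>) \<and> succ_fm n \<phi>' E = succ_fm k \<phi>' F"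
    using P by blast
  show "\<exists>(\<alpha>::'o) k \<phi>. Psi ar \<alpha> k \<phi> \<and> small E \<and> (\<forall>\<theta>\<in>E. Psi ar \<alpha> (Suc k) \<theta>) \<and> succ_fm n \<phi>' E = succ_fm k \<phi> E"
    using P by blast
  fix p assume "\<exists>(\<alpha>::'o) k F. Psi ar \<alpha> k p \<and> small F \<and> (\<forall>\<theta>\<in>F. Psi ar \<alpha> (Suc k) \<theta>) \<and> succ_fm n \<phi>' E = succ_fm k p F"
  then obtain a k F where "Psi ar (a::'o) k p" "small F" "succ_fm n \<phi>' E = succ_fm k p F" by auto
  from succ_fm_inject[where ar=ar and r=r, OF ar P(1) this(1) P(2) this(2,3)] show "p = \<phi>'" by simp
next
  fix F assume "\<exists>(\<alpha>::'o) k p. Psi ar \<alpha> k p \<and> small F \<and> (\<forall>\<theta>\<in>F. Psi ar \<alpha> (Suc k) \<theta>) \<and> succ_fm n \<phi>' E = succ_fm k p F"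
  then obtain a k p where "Psi ar (a::'o) k p" "small F" "succ_fm n \<phi>' E = succ_fm k p F" by auto
  from succ_fm_inject[where ar=ar and r=r, OF ar P(1) this(1) P(2) this(2,3)] show "F = E" by simp
qed

unbundle no cardinal_syntax


section \<open>Projections\<close>

text \<open>\<open>vproj ar \<alpha> \<beta>\<close> is \<open>V\<^bsub>\<alpha>,\<beta>\<^esub>\<close>, for \<open>\<alpha> \<le> \<beta>\<close>.\<close>

function vproj ::
  "('r \<Rightarrow> nat) \<Rightarrow> 'o::wellorder \<Rightarrow> 'o \<Rightarrow> ('r, 'o, 'k) formula \<Rightarrow> ('r, 'o, 'k) formula" where
  "vproj ar \<alpha> \<beta> \<phi> =
     (if \<alpha> = \<beta> then \<phi>
      else if \<exists>\<gamma>. is_succ \<gamma> \<beta> then vproj ar \<alpha> (opred \<beta>) (first_conj ar \<phi>)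
      else (THE \<psi>. \<psi> \<in> conjuncts \<phi> \<and> (\<exists>n. Psi ar \<alpha> n \<psi>)))"
  by pat_completeness auto
termination
  by (relation "inv_image {(\<alpha>, \<beta>). \<alpha> < \<beta>} (\<lambda>(ar, \<alpha>, \<beta>, \<phi>). \<beta>)")
     (auto simp: wf opred_less)

lemma vproj_limit:
  assumes ar: "ar r = 0" and l: "is_limit \<beta>" and P: "\<forall>b<\<beta>. Psi ar b n (\<psi> b :: ('r, 'o::wellorder, 'k) formula)" and ab: "\<alpha> < \<beta>"
  shows "vproj ar \<alpha> \<beta> (Conj (\<psi> ` {..<\<beta>})) = \<psi> \<alpha>"
proof -
  have "(THE x. x \<in> \<psi> ` {..<\<beta>} \<and> (\<exists>n. Psi ar \<alpha> n x)) = \<psi> \<alpha>"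
  proof (rule the_equality)
    fix x assume "x \<in> \<psi> ` {..<\<beta>} \<and> (\<exists>n. Psi ar \<alpha> n x)"
    then obtain b k where "b < \<beta>" "x = \<psi> b" "Psi ar \<alpha> k (\<psi> b)" by auto
    with Psi_unique[where ar=ar and r=r, OF ar, of b n "\<psi> b" \<alpha> k] P show "x = \<psi> \<alpha>" by auto
  qed (use P ab in auto)
  then show ?thesis using l ab by (subst vproj.simps) (simp add: conjuncts_limit is_limit_def less_imp_neq)
qed

text \<open>Injections from \<open>X\<^sub>m\<close> to \<open>X\<^sub>n\<close>, and the inclusion \<open>i\<^sub>m\<close>, are extensional functions on indices.\<close>

definition injections :: "nat \<Rightarrow> nat \<Rightarrow> (nat \<Rightarrow> nat) set" where
  "injections m n = {j \<in> {..<m} \<rightarrow>\<^sub>E {..<n}. inj_on j {..<m}}"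

definition incl :: "nat \<Rightarrow> nat \<Rightarrow> nat" where
  "incl m = (\<lambda>i\<in>{..<m}. i)"

definition diagram_proj :: "nat \<Rightarrow> (nat \<Rightarrow> nat) \<Rightarrow> ('r, 'k) fm \<Rightarrow> ('r, 'k) fm" where
  "diagram_proj m j \<phi> =
     (let ren = rename_atom (inv_into {..<m} j) in
      Conj ({Atom (ren a) | a. Atom a \<in> conjuncts \<phi> \<and> atom_vars a \<subseteq> j ` {..<m}} \<union>
            {Neg (Atom (ren a)) | a. Neg (Atom a) \<in> conjuncts \<phi> \<and> atom_vars a \<subseteq> j ` {..<m}}))"

text \<open>\<open>hproj ar \<alpha> m n \<phi> j\<close> is \<open>H\<^sup>n\<^sub>\<alpha>(\<phi>, j)\<close> for \<open>j\<close> in \<open>injections m n\<close>.\<close>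

function hproj :: "('r \<Rightarrow> nat) \<Rightarrow> 'o::wellorder \<Rightarrow> nat \<Rightarrow> nat \<Rightarrow>
    ('r, 'o, 'k) formula \<Rightarrow> (nat \<Rightarrow> nat) \<Rightarrow> ('r, 'o, 'k) formula" where
  "hproj ar \<alpha> m n \<phi> j =
     (if is_zero \<alpha> then diagram_proj m j \<phi>
      else if \<exists>\<beta>. is_succ \<beta> \<alpha> then
        succ_fm m
          (hproj ar (opred \<alpha>) m n (first_conj ar \<phi>) j)
          ((\<lambda>(\<theta>, y). hproj ar (opred \<alpha>) (Suc m) (Suc n) \<theta> (j(m := y)))
             ` (ext ar \<phi> \<times> ({..<Suc n} - j ` {..<m})))
      else Conj ((\<lambda>\<beta>. hproj ar \<beta> m n (vproj ar \<beta> \<alpha> \<phi>) j) ` {..<\<alpha>}))"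
  by pat_completeness auto
termination
  by (relation "inv_image {(\<alpha>, \<beta>). \<alpha> < \<beta>} (\<lambda>(ar, \<alpha>, m, n, \<phi>, j). \<alpha>)")
     (auto simp: wf opred_less)

declare vproj.simps [simp del] hproj.simps [simp del]


section \<open>Scott processes\<close>

definition slice ::
  "('r \<Rightarrow> nat) \<Rightarrow> ('o::wellorder \<Rightarrow> ('r, 'o, 'k) formula set) \<Rightarrow> 'o \<Rightarrow> nat \<Rightarrow> ('r, 'o, 'k) formula set"
where
  "slice ar \<Phi> \<alpha> n = {\<phi> \<in> \<Phi> \<alpha>. Psi ar \<alpha> n \<phi>}"

text \<open>
  The index set \<open>I\<close> is an initial segment of the ordinals: \<open>{..<\<delta>}\<close> for a process of length
  \<open>\<delta>\<close>, and \<open>{..\<delta>}\<close> for a process \<open>\<langle>\<Phi>\<^sub>\<alpha> : \<alpha> \<le> \<delta>\<rangle>\<close>, of length \<open>\<delta> + 1\<close>. The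
  values of \<open>\<Phi>\<close> outside \<open>I\<close> are irrelevant.
\<close>

definition scott_process ::
  "('r \<Rightarrow> nat) \<Rightarrow> 'o::wellorder set \<Rightarrow> ('o \<Rightarrow> ('r, 'o, 'k) formula set) \<Rightarrow> bool"
where
  "scott_process ar I \<Phi> \<longleftrightarrow>
     (\<forall>\<beta>\<in>I. \<forall>\<alpha><\<beta>. \<alpha> \<in> I) \<and>
     (\<forall>\<alpha>\<in>I. \<forall>\<phi>\<in>\<Phi> \<alpha>. \<exists>n. Psi ar \<alpha> n \<phi>) \<and>
     (\<forall>\<alpha> \<beta>. is_succ \<alpha> \<beta> \<and> \<beta> \<in> I \<longrightarrow> (\<forall>\<phi>\<in>\<Phi> \<beta>. ext ar \<phi> \<subseteq> \<Phi> \<alpha>)) \<and>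
     (\<forall>\<beta>\<in>I. \<forall>\<alpha><\<beta>. \<Phi> \<alpha> = vproj ar \<alpha> \<beta> ` \<Phi> \<beta>) \<and>
     (\<forall>\<alpha>\<in>I. \<forall>n. \<forall>\<phi>\<in>slice ar \<Phi> \<alpha> n. \<forall>j\<in>injections n n.
        hproj ar \<alpha> n n \<phi> j \<in> slice ar \<Phi> \<alpha> n) \<and>
     (\<forall>\<alpha>\<in>I. \<forall>m n. m < n \<longrightarrow>
        slice ar \<Phi> \<alpha> m = (\<lambda>\<phi>. hproj ar \<alpha> m n \<phi> (incl m)) ` slice ar \<Phi> \<alpha> n) \<and>
     (\<forall>\<alpha> \<beta>. is_succ \<alpha> \<beta> \<and> \<beta> \<in> I \<longrightarrow> (\<forall>n. \<forall>\<phi>\<in>slice ar \<Phi> \<beta> n.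
        ext ar \<phi> = vproj ar \<alpha> \<beta> `
          {\<psi> \<in> slice ar \<Phi> \<beta> (Suc n). hproj ar \<beta> n (Suc n) \<psi> (incl n) = \<phi>})) \<and>
     (\<forall>\<alpha> \<gamma> \<beta>. is_succ \<alpha> \<gamma> \<and> \<gamma> \<le> \<beta> \<and> \<beta> \<in> I \<longrightarrow> (\<forall>n. \<forall>\<phi>\<in>slice ar \<Phi> \<beta> n.
        ext ar (vproj ar \<gamma> \<beta> \<phi>) \<subseteq> vproj ar \<alpha> \<beta> `
          {\<psi> \<in> slice ar \<Phi> \<beta> (Suc n). hproj ar \<beta> n (Suc n) \<psi> (incl n) = \<phi>})) \<and>
     (\<forall>\<alpha>\<in>I. \<forall>n m. \<forall>\<phi>\<in>slice ar \<Phi> \<alpha> n. \<forall>\<psi>\<in>slice ar \<Phi> \<alpha> m.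
        \<exists>\<theta>\<in>slice ar \<Phi> \<alpha> (n + m). \<exists>j\<in>injections m (n + m).
          \<phi> = hproj ar \<alpha> n (n + m) \<theta> (incl n) \<and> \<psi> = hproj ar \<alpha> m (n + m) \<theta> j)"


section \<open>The Scott process of a structure\<close>

record ('r, 'a) struct =
  univ :: "'a set"
  interp :: "'r \<Rightarrow> 'a list set"

definition is_struct :: "('r \<Rightarrow> nat) \<Rightarrow> ('r, 'a) struct \<Rightarrow> bool" where
  "is_struct ar M \<longleftrightarrow> univ M \<noteq> {} \<and>
     (\<forall>r. interp M r \<subseteq> {xs. length xs = ar r \<and> set xs \<subseteq> univ M})"

fun sat_atom :: "('r, 'a) struct \<Rightarrow> 'a list \<Rightarrow> 'r atom \<Rightarrow> bool" where
  "sat_atom M a (Rel r is) \<longleftrightarrow> map ((!) a) is \<in> interp M r"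
| "sat_atom M a (Eq i k) \<longleftrightarrow> a ! i = a ! k"

function scott_fm :: "('r \<Rightarrow> nat) \<Rightarrow> ('r, 'a) struct \<Rightarrow> 'o::wellorder \<Rightarrow> 'a list \<Rightarrow> ('r, 'o, 'k) formula"
where
  "scott_fm ar M \<alpha> a =
     (if is_zero \<alpha> then diagram ar (length a) {p. sat_atom M a p}
      else if \<exists>\<beta>. is_succ \<beta> \<alpha> then
        succ_fm (length a) (scott_fm ar M (opred \<alpha>) a)
          ((\<lambda>c. scott_fm ar M (opred \<alpha>) (a @ [c])) ` (univ M - set a))
      else Conj ((\<lambda>\<beta>. scott_fm ar M \<beta> a) ` {..<\<alpha>}))"
  by pat_completeness auto
termination
  by (relation "inv_image {(\<alpha>, \<beta>). \<alpha> < \<beta>} (\<lambda>(ar, M, \<alpha>, a). \<alpha>)")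
     (auto simp: wf opred_less)

declare scott_fm.simps [simp del]

definition scott_level ::
  "('r \<Rightarrow> nat) \<Rightarrow> ('r, 'a) struct \<Rightarrow> 'o::wellorder \<Rightarrow> ('r, 'o, 'k) formula set" where
  "scott_level ar M \<alpha> = {scott_fm ar M \<alpha> a | a. distinct a \<and> set a \<subseteq> univ M}"

end

theory Submission
  imports Defs
begin

text \<open>
  Conditions (1e), (2b) and (2c) let one extend formulas in \<open>\<Phi>\<^sub>\<delta>\<close> step by step: a coherent sequence
  \<open>\<theta>\<^sub>k \<in> \<Phi>\<^sub>\<delta>\<close> in more and more variables is built so that every formula of \<open>\<Phi>\<^sub>\<delta>\<close> occurs as a
  horizontal projection of some \<open>\<theta>\<^sub>k\<close>, and so that whenever a projection \<open>\<phi>\<close> of \<open>\<theta>\<^sub>k\<close> has a one-point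
  extension \<open>\<rho> \<in> \<Phi>\<^sub>\<delta>\<close> and \<open>\<beta> < \<delta>\<close>, some later \<open>\<theta>\<^sub>k\<close> realizes over \<open>\<phi>\<close> a formula with the same vertical
  projection to \<open>\<beta>\<close> as \<open>\<rho>\<close>. Although \<open>\<delta>\<close> may be uncountable, countably many \<open>\<beta>\<close> suffice. By (1e) no
  arity dies out, so the variables form an infinite structure, in which the Scott formulas of a tuple
  are by induction the vertical projections of its formula in \<open>\<Phi>\<^sub>\<delta>\<close>.
\<close>

section \<open>Projections of formulas\<close>

lemma ordinal_cases [case_names zero succ limit]:
  fixes \<alpha> :: "'o::wellorder"
  obtains "is_zero \<alpha>" | \<gamma> where "is_succ \<gamma> \<alpha>" | "is_limit \<alpha>"
  unfolding is_limit_def by blast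

lemma is_succ_less: "is_succ \<alpha> \<beta> \<Longrightarrow> \<alpha> < \<beta>"
  by (simp add: is_succ_def)

lemma is_succ_le: "is_succ \<gamma> \<beta> \<Longrightarrow> \<alpha> < \<beta> \<Longrightarrow> \<alpha> \<le> \<gamma>"
  unfolding is_succ_def by (meson leD leI)

text \<open>A well-ordered type may have a largest element, so a successor of \<alpha> is available
  only when something lies above \<alpha>; it is then the least such ordinal.\<close>

lemma is_succ_exists:
  assumes "\<alpha> < (\<beta> :: 'o::wellorder)"
  obtains \<gamma> where "is_succ \<alpha> \<gamma>" "\<gamma> \<le> \<beta>"
proof
  show "is_succ \<alpha> (LEAST \<gamma>. \<alpha> < \<gamma>)"
    unfolding is_succ_def using LeastI[of "\<lambda>\<gamma>. \<alpha> < \<gamma>" \<beta>] assms by (auto intro: Least_le)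
  show "(LEAST \<gamma>. \<alpha> < \<gamma>) \<le> \<beta>"
    using assms by (rule Least_le)
qed

lemma not_less_zero: "is_zero \<alpha> \<Longrightarrow> \<not> \<beta> < \<alpha>"
  by (simp add: is_zero_def not_less)

lemma vproj_refl [simp]: "vproj ar \<alpha> \<alpha> \<phi> = \<phi>"
  by (subst vproj.simps) simp

lemma vproj_succ:
  "is_succ \<gamma> \<beta> \<Longrightarrow> \<alpha> < \<beta> \<Longrightarrow> vproj ar \<alpha> \<beta> \<phi> = vproj ar \<alpha> \<gamma> (first_conj ar \<phi>)"
  by (subst vproj.simps) (auto simp: opred_eq)

lemma hproj_zero: "is_zero \<alpha> \<Longrightarrow> hproj ar \<alpha> m n \<phi> j = diagram_proj m j \<phi>"
  by (subst hproj.simps) simp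

lemma hproj_succ:
  assumes "is_succ \<beta> \<alpha>"
  shows "hproj ar \<alpha> m n \<phi> j =
    succ_fm m (hproj ar \<beta> m n (first_conj ar \<phi>) j)
      ((\<lambda>(\<theta>, y). hproj ar \<beta> (Suc m) (Suc n) \<theta> (j(m := y)))
         ` (ext ar \<phi> \<times> ({..<Suc n} - j ` {..<m})))"
  using assms ordinal_kinds(4)[OF assms]
  by (subst hproj.simps) (auto simp: opred_eq)

lemma hproj_limit:
  "is_limit \<alpha> \<Longrightarrow> hproj ar \<alpha> m n \<phi> j = Conj ((\<lambda>\<beta>. hproj ar \<beta> m n (vproj ar \<beta> \<alpha> \<phi>) j) ` {..<\<alpha>})"
  by (subst hproj.simps) (auto simp: is_limit_def)

section \<open>Injections between finite sets of variables\<close>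

lemma injections_le: "j \<in> injections m n \<Longrightarrow> m \<le> n"
  unfolding injections_def using card_inj_on_le[of j "{..<m}" "{..<n}"] by (auto simp: PiE_iff)

lemma injections_image: "j \<in> injections m n \<Longrightarrow> j ` {..<m} \<subseteq> {..<n}"
  unfolding injections_def by (auto simp: PiE_iff)

lemma injections_update:
  assumes "j \<in> injections m n" "y < Suc n" "y \<notin> j ` {..<m}"
  shows "j(m := y) \<in> injections (Suc m) (Suc n)"
  using assms unfolding injections_def
  by (auto simp: PiE_iff extensional_def inj_on_def less_Suc_eq)

lemma incl_injections: "m \<le> n \<Longrightarrow> incl m \<in> injections m n"
  by (auto simp: incl_def injections_def inj_on_def)

lemma compose_injections:
  "j \<in> injections m n \<Longrightarrow> k \<in> injections l m \<Longrightarrow> compose {..<l} j k \<in> injections l n"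
  unfolding injections_def inj_on_def compose_def PiE_iff Ball_def by auto

lemma compose_incl:
  assumes "j \<in> injections m n"
  shows "compose {..<m} (incl n) j = j"
  using assms by (auto simp: injections_def compose_def incl_def PiE_iff extensional_def fun_eq_iff)

section \<open>Inversion of membership in \<open>Psi\<close> and composition of vertical
  projections\<close>

context
  fixes ar :: "'r \<Rightarrow> nat" and r
  assumes ar: "ar r = 0"
begin

text \<open>Only the successor rule applies at a successor index, and its parameters are determined
  by the formula, so \<open>first_conj\<close> and \<open>ext\<close> recover them.\<close>

lemma Psi_succE:
  assumes "Psi ar \<beta> n (\<phi> :: ('r, 'o::wellorder, 'k) formula)" "is_succ \<alpha> \<beta>"
  shows "Psi ar \<alpha> n (first_conj ar \<phi>)" "small (ext ar \<phi>)"
    "\<And>\<theta>. \<theta> \<in> ext ar \<phi> \<Longrightarrow> Psi ar \<alpha> (Suc n) \<theta>"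
    "\<phi> = succ_fm n (first_conj ar \<phi>) (ext ar \<phi>)"
proof -
  from assms(1) obtain \<phi>' E where *: "Psi ar \<alpha> n \<phi>'" "small E" "\<forall>\<theta>\<in>E. Psi ar \<alpha> (Suc n) \<theta>"
      "\<phi> = succ_fm n \<phi>' E"
  proof cases
    case (succ \<gamma> \<phi>' E)
    then show ?thesis using is_succ_pred_unique[OF succ(2) assms(2)] that by blast
  qed (use assms(2) ordinal_kinds in blast)+
  then have "first_conj ar \<phi> = \<phi>'" "ext ar \<phi> = E"
    using first_conj_ext[where ar=ar and r=r, OF ar] by blast+
  with * show "Psi ar \<alpha> n (first_conj ar \<phi>)" "small (ext ar \<phi>)"
    "\<And>\<theta>. \<theta> \<in> ext ar \<phi> \<Longrightarrow> Psi ar \<alpha> (Suc n) \<theta>"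
    "\<phi> = succ_fm n (first_conj ar \<phi>) (ext ar \<phi>)" by auto
qed

text \<open>Each conjunct of a limit formula is the only one of its level, so the family in the
  limit rule must consist of the vertical projections; they inherit the coherence demanded there at
  successors and at limits.\<close>

lemma Psi_limitE:
  assumes "Psi ar \<alpha> n (\<phi> :: ('r, 'o::wellorder, 'k) formula)" "is_limit \<alpha>"
  shows "\<phi> = Conj ((\<lambda>\<beta>. vproj ar \<beta> \<alpha> \<phi>) ` {..<\<alpha>})"
    "\<And>\<beta>. \<beta> < \<alpha> \<Longrightarrow> Psi ar \<beta> n (vproj ar \<beta> \<alpha> \<phi>)"
    "\<And>\<beta> \<gamma>. is_succ \<beta> \<gamma> \<Longrightarrow> \<gamma> < \<alpha> \<Longrightarrow> first_conj ar (vproj ar \<gamma> \<alpha> \<phi>) = vproj ar \<beta> \<alpha> \<phi>"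
    "\<And>\<beta>. is_limit \<beta> \<Longrightarrow> \<beta> < \<alpha> \<Longrightarrow> vproj ar \<beta> \<alpha> \<phi> = Conj ((\<lambda>\<gamma>. vproj ar \<gamma> \<alpha> \<phi>) ` {..<\<beta>})"
proof -
  from assms(1) obtain \<psi> where *: "\<forall>\<beta><\<alpha>. Psi ar \<beta> n (\<psi> \<beta>)"
    "\<forall>\<beta> \<gamma>. is_succ \<beta> \<gamma> \<and> \<gamma> < \<alpha> \<longrightarrow>
          (\<exists>E. small E \<and> (\<forall>\<theta>\<in>E. Psi ar \<beta> (Suc n) \<theta>) \<and> \<psi> \<gamma> = succ_fm n (\<psi> \<beta>) E)"
    "\<forall>\<beta><\<alpha>. is_limit \<beta> \<longrightarrow> \<psi> \<beta> = Conj (\<psi> ` {..<\<beta>})"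
    "\<phi> = Conj (\<psi> ` {..<\<alpha>})"
  proof cases
    case (limit \<psi>)
    then show ?thesis using that by blast
  qed (use assms(2) ordinal_kinds in blast)+
  have v: "vproj ar \<beta> \<alpha> \<phi> = \<psi> \<beta>" if "\<beta> < \<alpha>" for \<beta>
    using vproj_limit[where ar=ar and r=r, OF ar assms(2) *(1) that] *(4) by simp
  show "\<phi> = Conj ((\<lambda>\<beta>. vproj ar \<beta> \<alpha> \<phi>) ` {..<\<alpha>})"
    using *(4) v by (metis (no_types, lifting) image_cong lessThan_iff)
  show "Psi ar \<beta> n (vproj ar \<beta> \<alpha> \<phi>)" if "\<beta> < \<alpha>" for \<beta>
    using *(1) v that by simp
  show "first_conj ar (vproj ar \<gamma> \<alpha> \<phi>) = vproj ar \<beta> \<alpha> \<phi>" if succ: "is_succ \<beta> \<gamma>" "\<gamma> < \<alpha>" for \<beta> \<gamma>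
  proof -
    have "\<beta> < \<alpha>" using succ is_succ_less by fastforce
    moreover obtain E where E: "small E" "\<forall>\<theta>\<in>E. Psi ar \<beta> (Suc n) \<theta>" "\<psi> \<gamma> = succ_fm n (\<psi> \<beta>) E"
      using *(2) succ by blast
    ultimately show ?thesis
      using first_conj_ext(1)[where ar=ar and r=r, OF ar, of \<beta> n "\<psi> \<beta>" E] *(1) v succ by simp
  qed
  show "vproj ar \<beta> \<alpha> \<phi> = Conj ((\<lambda>\<gamma>. vproj ar \<gamma> \<alpha> \<phi>) ` {..<\<beta>})" if "is_limit \<beta>" "\<beta> < \<alpha>" for \<beta>
  proof -
    have "(\<lambda>\<gamma>. vproj ar \<gamma> \<alpha> \<phi>) ` {..<\<beta>} = \<psi> ` {..<\<beta>}"
      using that(2) v by (intro image_cong refl) auto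
    then show ?thesis using *(3) v that by simp
  qed
qed

lemma Psi_vproj:
  "Psi ar \<beta> n (\<phi> :: ('r, 'o::wellorder, 'k) formula) \<Longrightarrow> \<alpha> \<le> \<beta> \<Longrightarrow> Psi ar \<alpha> n (vproj ar \<alpha> \<beta> \<phi>)"
proof (induction \<beta> arbitrary: \<phi> rule: less_induct)
  case (less \<beta>)
  show ?case
  proof (cases "\<alpha> = \<beta>")
    case True
    then show ?thesis using less.prems by simp
  next
    case False
    then have lt: "\<alpha> < \<beta>" using less.prems by simp
    show ?thesis
    proof (cases \<beta> rule: ordinal_cases)
      case zero
      then show ?thesis using lt not_less_zero by blast
    next
      case (succ \<gamma>)
      then show ?thesis
        using less.IH[OF is_succ_less[OF succ] Psi_succE(1)[OF less.prems(1) succ]]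
          is_succ_le[OF succ lt] by (simp add: vproj_succ[OF succ lt])
    next
      case limit
      then show ?thesis using Psi_limitE(2)[OF less.prems(1)] lt by blast
    qed
  qed
qed

text \<open>From a limit, \<open>vproj\<close> picks out a conjunct at once, whereas below the limit
  it may descend step by step. Induction on the intermediate level compares the two by the coherence
  of the conjuncts.\<close>

lemma vproj_vproj_limit:
  assumes "Psi ar \<delta> n (\<phi> :: ('r, 'o::wellorder, 'k) formula)" "is_limit \<delta>"
  shows "\<alpha> \<le> \<beta> \<Longrightarrow> \<beta> < \<delta> \<Longrightarrow> vproj ar \<alpha> \<beta> (vproj ar \<beta> \<delta> \<phi>) = vproj ar \<alpha> \<delta> \<phi>"
proof (induction \<beta> rule: less_induct)
  case (less \<beta>)
  show ?case
  proof (cases "\<alpha> = \<beta>")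
    case False
    then have lt: "\<alpha> < \<beta>" using less.prems by simp
    show ?thesis
    proof (cases \<beta> rule: ordinal_cases)
      case zero
      then show ?thesis using lt not_less_zero by blast
    next
      case (succ \<gamma>)
      then show ?thesis
        using less.IH[OF is_succ_less[OF succ]] is_succ_le[OF succ lt] is_succ_less[OF succ] less.prems(2)
        by (simp add: vproj_succ[OF succ lt] Psi_limitE(3)[OF assms succ])
    next
      case limit
      then show ?thesis
        using vproj_limit[where ar=ar and r=r, OF ar limit, of n "\<lambda>\<gamma>. vproj ar \<gamma> \<delta> \<phi>", OF _ lt] Psi_limitE(2)[OF assms]
          Psi_limitE(4)[OF assms limit] less.prems(2) by (simp add: order_less_trans)
    qed
  qed simp
qed

lemma vproj_vproj:
  "Psi ar \<gamma> n (\<phi> :: ('r, 'o::wellorder, 'k) formula) \<Longrightarrow> \<alpha> \<le> \<beta> \<Longrightarrow> \<beta> \<le> \<gamma> \<Longrightarrow>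
    vproj ar \<alpha> \<beta> (vproj ar \<beta> \<gamma> \<phi>) = vproj ar \<alpha> \<gamma> \<phi>"
proof (induction \<gamma> arbitrary: \<phi> rule: less_induct)
  case (less \<gamma>)
  show ?case
  proof (cases "\<beta> = \<gamma>")
    case False
    then have lt: "\<beta> < \<gamma>" using less.prems by simp
    show ?thesis
    proof (cases \<gamma> rule: ordinal_cases)
      case zero
      then show ?thesis using lt not_less_zero by blast
    next
      case (succ \<gamma>')
      then show ?thesis
        using less.IH[OF is_succ_less[OF succ] Psi_succE(1)[OF less.prems(1) succ] less.prems(2)]
          is_succ_le[OF succ lt] less.prems(2) lt by (simp add: vproj_succ[OF succ])
    next
      case limit
      then show ?thesis using vproj_vproj_limit[OF less.prems(1)] less.prems(2) lt by blast
    qed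
  qed simp
qed

lemma first_conj_vproj:
  assumes "Psi ar \<gamma> n (\<phi> :: ('r, 'o::wellorder, 'k) formula)" "is_succ \<alpha> \<beta>" "\<beta> \<le> \<gamma>"
  shows "first_conj ar (vproj ar \<beta> \<gamma> \<phi>) = vproj ar \<alpha> \<gamma> \<phi>"
  using vproj_vproj[OF assms(1) _ assms(3), of \<alpha>] is_succ_less[OF assms(2)]
  by (simp add: vproj_succ[OF assms(2)])

lemma Psi_zeroE:
  assumes "Psi ar \<alpha> n (\<phi> :: ('r, 'o::wellorder, 'k) formula)" "is_zero \<alpha>"
  obtains S where "\<forall>i<n. \<forall>k<n. Eq i k \<in> S \<longleftrightarrow> i = k" "\<phi> = diagram ar n S"
  using assms by cases (auto dest: ordinal_kinds)

end

section \<open>Renaming of variables in atoms and in diagrams\<close>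

lemma rename_atom_rename_atom: "rename_atom f (rename_atom g p) = rename_atom (f \<circ> g) p"
  by (cases p) auto

lemma rename_atom_cong: "(\<And>i. i \<in> atom_vars p \<Longrightarrow> f i = g i) \<Longrightarrow> rename_atom f p = rename_atom g p"
  by (cases p) auto

lemma rename_atom_id [simp]: "rename_atom (\<lambda>i. i) p = p"
  by (cases p) auto

lemma atom_vars_rename_atom [simp]: "atom_vars (rename_atom f p) = f ` atom_vars p"
  by (cases p) auto

lemma atom_vars_atoms: "p \<in> atoms ar n \<Longrightarrow> atom_vars p \<subseteq> {..<n}"
  by (auto simp: atoms_def)

lemma rename_atom_atoms: "p \<in> atoms ar m \<Longrightarrow> f ` {..<m} \<subseteq> {..<n} \<Longrightarrow> rename_atom f p \<in> atoms ar n"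
  by (force simp: atoms_def)

lemma atoms_preimage:
  assumes "p \<in> atoms ar n" "inj_on j {..<m}" "atom_vars p \<subseteq> j ` {..<m}"
  shows "rename_atom (inv_into {..<m} j) p \<in> atoms ar m"
    "rename_atom j (rename_atom (inv_into {..<m} j) p) = p"
proof -
  have *: "inv_into {..<m} j i < m" if "i \<in> j ` {..<m}" for i
    using inv_into_into[OF that] by simp
  show "rename_atom (inv_into {..<m} j) p \<in> atoms ar m"
    using assms(1,3) * by (fastforce simp: atoms_def)
  show "rename_atom j (rename_atom (inv_into {..<m} j) p) = p"
    unfolding rename_atom_rename_atom
    by (rule trans[OF rename_atom_cong rename_atom_id]) (use assms(3) in \<open>auto intro: f_inv_into_f\<close>)
qed

lemma diagram_cong: "(\<And>p. p \<in> atoms ar n \<Longrightarrow> p \<in> S \<longleftrightarrow> p \<in> T) \<Longrightarrow> diagram ar n S = diagram ar n T"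
  unfolding diagram_def by (rule arg_cong[of _ _ Conj]) auto

text \<open>Renaming along the injection \<open>j\<close> is a bijection between the atoms in
  \<open>m\<close> variables and those atoms in \<open>n\<close> variables that mention only the
  range of \<open>j\<close>. Positive and negative literals are matched separately.\<close>

lemma diagram_proj_diagram:
  assumes "j \<in> injections m n"
  shows "diagram_proj m j (diagram ar n S :: ('r, 'o, 'k) formula) =
    diagram ar m {p. rename_atom j p \<in> S}"
proof -
  have inj: "inj_on j {..<m}" and im: "j ` {..<m} \<subseteq> {..<n}"
    using assms injections_image by (auto simp: injections_def)
  let ?ren = "rename_atom (inv_into {..<m} j)"
  have ren: "?ren (rename_atom j p) = p" if "p \<in> atoms ar m" for p :: "'r atom"
    unfolding rename_atom_rename_atom
    by (rule trans[OF rename_atom_cong rename_atom_id])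
       (use atom_vars_atoms[OF that] inv_into_f_f[OF inj] in auto)
  have preim: "p = ?ren (rename_atom j p)" "rename_atom j p \<in> atoms ar n"
    "atom_vars (rename_atom j p) \<subseteq> j ` {..<m}" if "p \<in> atoms ar m" for p :: "'r atom"
    using ren[OF that] rename_atom_atoms[OF that im] atom_vars_atoms[OF that] by auto
  have "{?ren a | a. a \<in> atoms ar n \<and> a \<in> S \<and> atom_vars a \<subseteq> j ` {..<m}} = atoms ar m \<inter> {p. rename_atom j p \<in> S}"
    (is "?A = _")
  proof (intro equalityI subsetI)
    fix p assume "p \<in> ?A"
    then show "p \<in> atoms ar m \<inter> {p. rename_atom j p \<in> S}"
      using atoms_preimage[OF _ inj] by force
  next
    fix p assume "p \<in> atoms ar m \<inter> {p. rename_atom j p \<in> S}"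
    then show "p \<in> ?A" using preim[of p] by blast
  qed
  moreover have "{?ren a | a. a \<in> atoms ar n \<and> a \<notin> S \<and> atom_vars a \<subseteq> j ` {..<m}} = atoms ar m - {p. rename_atom j p \<in> S}"
    (is "?B = _")
  proof (intro equalityI subsetI)
    fix p assume "p \<in> ?B"
    then show "p \<in> atoms ar m - {p. rename_atom j p \<in> S}"
      using atoms_preimage[OF _ inj] by force
  next
    fix p assume "p \<in> atoms ar m - {p. rename_atom j p \<in> S}"
    then show "p \<in> ?B" using preim[of p] by blast
  qed
  moreover have "{Atom (?ren a) | a. Atom a \<in> conjuncts (diagram ar n S :: ('r, 'o, 'k) formula) \<and> atom_vars a \<subseteq> j ` {..<m}} =
      Atom ` {?ren a | a. a \<in> atoms ar n \<and> a \<in> S \<and> atom_vars a \<subseteq> j ` {..<m}}"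
    unfolding conjuncts_diagram by (simp add: image_def fm_simps) blast
  moreover have "{Neg (Atom (?ren a)) | a. Neg (Atom a) \<in> conjuncts (diagram ar n S :: ('r, 'o, 'k) formula) \<and> atom_vars a \<subseteq> j ` {..<m}} =
      (Neg \<circ> Atom) ` {?ren a | a. a \<in> atoms ar n \<and> a \<notin> S \<and> atom_vars a \<subseteq> j ` {..<m}}"
    unfolding conjuncts_diagram by (simp add: image_def fm_simps) blast
  ultimately show ?thesis unfolding diagram_proj_def Let_def diagram_def[of ar m] by metis
qed

text \<open>At a successor level, a horizontal projection takes an image of the product of
  \<open>ext\<close> with a finite set of variables; such an image is a finite union of images of
  one small set.\<close>

lemma small_image_Times:
  assumes "small (E :: ('r, 'k) fm set)" "finite Y"
  shows "small ((\<lambda>(\<theta>, y). (f \<theta> y :: ('r, 'k) fm)) ` (E \<times> Y))"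
  using assms(2)
proof induction
  case empty
  then show ?case by (simp add: small_countable)
next
  case (insert y Y)
  have "(\<lambda>(\<theta>, y). f \<theta> y) ` (E \<times> insert y Y) = (\<lambda>\<theta>. f \<theta> y) ` E \<union> (\<lambda>(\<theta>, y). f \<theta> y) ` (E \<times> Y)"
    by auto
  then show ?case using small_Un[OF small_image'[OF assms(1)] insert.IH] by simp
qed

section \<open>Horizontal projections and their laws\<close>

context
  fixes ar :: "'r \<Rightarrow> nat" and r
  assumes ar: "ar r = 0"
begin

text \<open>Besides membership at each lower level, the limit rule asks for coherence. At successors
  it follows from the shape of \<open>hproj\<close> and the coherence of \<phi>, at limits from the
  composition of vertical projections.\<close>

lemma Psi_hproj:
  "Psi ar \<alpha> n (\<phi> :: ('r, 'o::wellorder, 'k) formula) \<Longrightarrow> j \<in> injections m n \<Longrightarrow>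
    Psi ar \<alpha> m (hproj ar \<alpha> m n \<phi> j)"
proof (induction \<alpha> arbitrary: n \<phi> j m rule: less_induct)
  case (less \<alpha>)
  note Psi_succ = Psi_succE[where ar=ar and r=r, OF ar]
  note Psi_limit = Psi_limitE[where ar=ar and r=r, OF ar]
  show ?case
  proof (cases \<alpha> rule: ordinal_cases)
    case zero
    obtain S where S: "\<forall>i<n. \<forall>k<n. Eq i k \<in> S \<longleftrightarrow> i = k" "\<phi> = diagram ar n S"
      using Psi_zeroE[where ar=ar and r=r, OF ar less.prems(1) zero] .
    have "j i < n" if "i < m" for i
      using injections_image[OF less.prems(2)] that by auto
    \<comment> \<open>Injectivity of \<open>j\<close> ensures that the projected diagram again
      declares distinct variables unequal.\<close>
    moreover have "j i = j k \<longleftrightarrow> i = k" if "i < m" "k < m" for i k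
      using less.prems(2) that by (auto simp: injections_def inj_on_def)
    ultimately have "\<forall>i<m. \<forall>k<m. Eq i k \<in> {p. rename_atom j p \<in> S} \<longleftrightarrow> i = k"
      using S(1) by simp
    then show ?thesis
      unfolding hproj_zero[OF zero] S(2) diagram_proj_diagram[OF less.prems(2)]
      by (rule Psi.zero[OF zero])
  next
    case (succ \<beta>)
    note lt = is_succ_less[OF succ]
    have "Psi ar \<beta> (Suc m) (hproj ar \<beta> (Suc m) (Suc n) \<theta> (j(m := y)))"
      if "\<theta> \<in> ext ar \<phi>" "y < Suc n" "y \<notin> j ` {..<m}" for \<theta> y
      by (rule less.IH[OF lt Psi_succ(3)[OF less.prems(1) succ that(1)]
          injections_update[OF less.prems(2) that(2,3)]])
    then show ?thesis
      unfolding hproj_succ[OF succ]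
      by (intro Psi.succ[OF succ] less.IH[OF lt Psi_succ(1)[OF less.prems(1) succ] less.prems(2)]
           small_image_Times Psi_succ(2)[OF less.prems(1) succ]) auto
  next
    case limit
    let ?\<psi> = "\<lambda>\<beta>. hproj ar \<beta> m n (vproj ar \<beta> \<alpha> \<phi>) j"
    have P: "Psi ar \<beta> m (?\<psi> \<beta>)" if "\<beta> < \<alpha>" for \<beta>
      using less.IH[OF that Psi_limit(2)[OF less.prems(1) limit that] less.prems(2)] .
    have "\<exists>E. small E \<and> (\<forall>\<theta>\<in>E. Psi ar \<beta> (Suc m) \<theta>) \<and> ?\<psi> \<gamma> = succ_fm m (?\<psi> \<beta>) E"
      if "is_succ \<beta> \<gamma>" "\<gamma> < \<alpha>" for \<beta> \<gamma>
    proof -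
      note V = Psi_limit(2)[OF less.prems(1) limit that(2)]
      have lt: "\<beta> < \<alpha>" using is_succ_less[OF that(1)] that(2) by simp
      have "Psi ar \<beta> (Suc m) (hproj ar \<beta> (Suc m) (Suc n) \<theta> (j(m := y)))"
        if "\<theta> \<in> ext ar (vproj ar \<gamma> \<alpha> \<phi>)" "y < Suc n" "y \<notin> j ` {..<m}" for \<theta> y
        by (rule less.IH[OF lt Psi_succ(3)[OF V \<open>is_succ \<beta> \<gamma>\<close> that(1)]
            injections_update[OF less.prems(2) that(2,3)]])
      then show ?thesis
        unfolding hproj_succ[OF that(1)] Psi_limit(3)[OF less.prems(1) limit that]
        by (intro exI conjI, rule_tac[3] refl)
           (auto intro!: small_image_Times Psi_succ(2)[OF V that(1)])
    qed
    moreover have "?\<psi> \<beta> = Conj (?\<psi> ` {..<\<beta>})" if "\<beta> < \<alpha>" "is_limit \<beta>" for \<beta>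
    proof -
      have "vproj ar \<gamma> \<beta> (vproj ar \<beta> \<alpha> \<phi>) = vproj ar \<gamma> \<alpha> \<phi>" if "\<gamma> < \<beta>" for \<gamma>
        by (rule vproj_vproj[where ar=ar and r=r, OF ar less.prems(1)]) (use that \<open>\<beta> < \<alpha>\<close> in auto)
      then show ?thesis
        unfolding hproj_limit[OF that(2)] by (intro arg_cong[of _ _ Conj] image_cong) auto
    qed
    ultimately show ?thesis
      unfolding hproj_limit[OF limit] using P by (intro Psi.limit[OF limit]) auto
  qed
qed

text \<open>The components are read off the defining equation of \<open>hproj\<close>.
  \<open>Psi_hproj\<close> shows that they lie in the right levels, which is what uniqueness of the
  decomposition requires.\<close>

lemma ext_hproj:
  assumes "Psi ar \<beta> n (\<phi> :: ('r, 'o::wellorder, 'k) formula)" "j \<in> injections m n" "is_succ \<alpha> \<beta>"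
  shows "first_conj ar (hproj ar \<beta> m n \<phi> j) = hproj ar \<alpha> m n (first_conj ar \<phi>) j"
    "ext ar (hproj ar \<beta> m n \<phi> j) =
      {hproj ar \<alpha> (Suc m) (Suc n) \<theta> (j(m := y)) | \<theta> y. \<theta> \<in> ext ar \<phi> \<and> y < Suc n \<and> y \<notin> j ` {..<m}}"
proof -
  note Psi_succ = Psi_succE[where ar=ar and r=r, OF ar assms(1,3)]
  let ?E = "(\<lambda>(\<theta>, y). hproj ar \<alpha> (Suc m) (Suc n) \<theta> (j(m := y))) ` (ext ar \<phi> \<times> ({..<Suc n} - j ` {..<m}))"
  have P: "Psi ar \<alpha> m (hproj ar \<alpha> m n (first_conj ar \<phi>) j)"
    by (rule Psi_hproj[OF Psi_succ(1) assms(2)])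
  have s: "small ?E"
    by (intro small_image_Times Psi_succ(2)) auto
  have E: "\<forall>\<theta>\<in>?E. Psi ar \<alpha> (Suc m) \<theta>"
    using Psi_hproj[OF Psi_succ(3) injections_update[OF assms(2)]] by auto
  show "first_conj ar (hproj ar \<beta> m n \<phi> j) = hproj ar \<alpha> m n (first_conj ar \<phi>) j"
    unfolding hproj_succ[OF assms(3)] by (rule first_conj_ext(1)[where ar=ar and r=r, OF ar P s E])
  have "ext ar (hproj ar \<beta> m n \<phi> j) = ?E"
    unfolding hproj_succ[OF assms(3)] by (rule first_conj_ext(2)[where ar=ar and r=r, OF ar P s E])
  also have "?E = {hproj ar \<alpha> (Suc m) (Suc n) \<theta> (j(m := y)) | \<theta> y. \<theta> \<in> ext ar \<phi> \<and> y < Suc n \<and> y \<notin> j ` {..<m}}"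
    by auto
  finally show "ext ar (hproj ar \<beta> m n \<phi> j) =
      {hproj ar \<alpha> (Suc m) (Suc n) \<theta> (j(m := y)) | \<theta> y. \<theta> \<in> ext ar \<phi> \<and> y < Suc n \<and> y \<notin> j ` {..<m}}" .
qed

text \<open>The recursion for \<open>hproj\<close> acts on the first conjunct of a successor formula
  and on each conjunct of a limit formula, and these are what \<open>vproj\<close> selects; so the
  order of the two does not matter.\<close>

lemma vproj_hproj:
  "Psi ar \<beta> n (\<phi> :: ('r, 'o::wellorder, 'k) formula) \<Longrightarrow> j \<in> injections m n \<Longrightarrow> \<alpha> \<le> \<beta> \<Longrightarrow>
    vproj ar \<alpha> \<beta> (hproj ar \<beta> m n \<phi> j) = hproj ar \<alpha> m n (vproj ar \<alpha> \<beta> \<phi>) j"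
proof (induction \<beta> arbitrary: \<phi> rule: less_induct)
  case (less \<beta>)
  show ?case
  proof (cases "\<alpha> = \<beta>")
    case False
    then have lt: "\<alpha> < \<beta>" using less.prems by simp
    show ?thesis
    proof (cases \<beta> rule: ordinal_cases)
      case zero
      then show ?thesis using lt not_less_zero by blast
    next
      case (succ \<gamma>)
      show ?thesis
        unfolding vproj_succ[OF succ lt] ext_hproj(1)[OF less.prems(1,2) succ]
        by (rule less.IH[OF is_succ_less[OF succ]
            Psi_succE(1)[where ar=ar and r=r, OF ar less.prems(1) succ]
            less.prems(2) is_succ_le[OF succ lt]])
    next
      case limit
      show ?thesis
        unfolding hproj_limit[OF limit]
        by (rule vproj_limit[where ar=ar and r=r and n=m, OF ar limit _ lt])
           (use Psi_hproj[OF Psi_vproj[where ar=ar and r=r, OF ar less.prems(1)] less.prems(2)] in auto)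
    qed
  qed simp
qed

text \<open>In the successor step, extending both \<open>j\<close> and \<open>k\<close> by fresh
  values gives exactly the extensions of the composite by a fresh value. Equality of the first
  conjuncts and of the \<open>ext\<close> sets then gives equality of the formulas.\<close>

lemma hproj_hproj:
  "Psi ar \<alpha> n (\<phi> :: ('r, 'o::wellorder, 'k) formula) \<Longrightarrow> j \<in> injections m n \<Longrightarrow> k \<in> injections l m \<Longrightarrow>
    hproj ar \<alpha> l m (hproj ar \<alpha> m n \<phi> j) k = hproj ar \<alpha> l n \<phi> (compose {..<l} j k)"
proof (induction \<alpha> arbitrary: l m n \<phi> j k rule: less_induct)
  case (less \<alpha>)
  note P = less.prems(1) and j = less.prems(2) and k = less.prems(3)
  note jk = compose_injections[OF j k]
  show ?case
  proof (cases \<alpha> rule: ordinal_cases)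
    case zero
    obtain S where S: "\<phi> = diagram ar n S"
      using Psi_zeroE[where ar=ar and r=r, OF ar P zero] .
    have "rename_atom j (rename_atom k p) = rename_atom (compose {..<l} j k) p"
      if "p \<in> atoms ar l" for p
      unfolding rename_atom_rename_atom
      by (rule rename_atom_cong) (use atom_vars_atoms[OF that] in \<open>auto simp: compose_def\<close>)
    then show ?thesis
      unfolding hproj_zero[OF zero] S diagram_proj_diagram[OF j] diagram_proj_diagram[OF k]
        diagram_proj_diagram[OF jk] by (intro diagram_cong) simp
  next
    case (succ \<beta>)
    note lt = is_succ_less[OF succ]
    have sub: "j ` {..<m} \<subseteq> {..<n}" "k ` {..<l} \<subseteq> {..<m}"
      using injections_image j k by auto
    have upd: "hproj ar \<beta> (Suc l) (Suc m) (hproj ar \<beta> (Suc m) (Suc n) \<theta> (j(m := y))) (k(l := z)) =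
        hproj ar \<beta> (Suc l) (Suc n) \<theta> ((compose {..<l} j k)(l := (j(m := y)) z))"
      if "\<theta> \<in> ext ar \<phi>" "y < Suc n" "y \<notin> j ` {..<m}" "z < Suc m" "z \<notin> k ` {..<l}" for \<theta> y z
    proof -
      \<comment> \<open>On the old indices \<open>k\<close> takes values below \<open>m\<close>,
        where the update of \<open>j\<close> at \<open>m\<close> has no effect.\<close>
      have eq: "compose {..<Suc l} (j(m := y)) (k(l := z)) = (compose {..<l} j k)(l := (j(m := y)) z)"
        using sub(2) by (auto simp: compose_def fun_eq_iff less_Suc_eq)
      show ?thesis
        unfolding eq[symmetric]
        by (rule less.IH[OF lt Psi_succE(3)[where ar=ar and r=r, OF ar P succ that(1)]
            injections_update[OF j that(2,3)] injections_update[OF k that(4,5)]])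
    qed
    have "{hproj ar \<beta> (Suc l) (Suc m) \<theta>' (k(l := z)) | \<theta>' z. \<theta>' \<in> ext ar (hproj ar \<alpha> m n \<phi> j) \<and> z < Suc m \<and> z \<notin> k ` {..<l}}
      = {hproj ar \<beta> (Suc l) (Suc n) \<theta> ((compose {..<l} j k)(l := w)) | \<theta> w. \<theta> \<in> ext ar \<phi> \<and> w < Suc n \<and> w \<notin> compose {..<l} j k ` {..<l}}"
      (is "?A = ?B")
    proof (intro equalityI subsetI)
      fix x assume "x \<in> ?A"
      then obtain \<theta> y z where *: "\<theta> \<in> ext ar \<phi>" "y < Suc n" "y \<notin> j ` {..<m}" "z < Suc m" "z \<notin> k ` {..<l}"
        and x: "x = hproj ar \<beta> (Suc l) (Suc m) (hproj ar \<beta> (Suc m) (Suc n) \<theta> (j(m := y))) (k(l := z))"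
        unfolding ext_hproj(2)[OF P j succ] by blast
      have "(j(m := y)) z < Suc n"
        using *(2,4) sub(1) by (auto simp: less_Suc_eq)
      moreover have "(j(m := y)) z \<notin> compose {..<l} j k ` {..<l}"
      proof
        assume "(j(m := y)) z \<in> compose {..<l} j k ` {..<l}"
        then obtain i where i: "i < l" "(j(m := y)) z = j (k i)" by (auto simp: compose_def)
        then have ki: "k i < m" "k i \<noteq> z" using sub(2) *(5) by auto
        show False
        \<comment> \<open>Either \<open>z\<close> is the new index, whose value \<open>y\<close> is
          fresh for \<open>j\<close>, or both indices are old and injectivity of \<open>j\<close>
          separates them.\<close>
        proof (cases "z = m")
          case True
          then show ?thesis using i(2) ki(1) *(3) by auto
        next
          case False
          then have "z < m" using *(4) by simp
          then show ?thesis using i(2) ki j False by (auto simp: injections_def inj_on_def)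
        qed
      qed
      ultimately show "x \<in> ?B" unfolding x upd[OF *] using *(1) by blast
    next
      fix x assume "x \<in> ?B"
      then obtain \<theta> w where \<theta>: "\<theta> \<in> ext ar \<phi>" and w: "w < Suc n" "w \<notin> compose {..<l} j k ` {..<l}"
        and x: "x = hproj ar \<beta> (Suc l) (Suc n) \<theta> ((compose {..<l} j k)(l := w))" by blast
      \<comment> \<open>An old value \<open>w\<close> of \<open>j\<close> is reached through its
        preimage, with \<open>n\<close> as an otherwise idle fresh value for \<open>j\<close>; any
        other \<open>w\<close> is itself taken as that fresh value and reached through the new index
        \<open>m\<close>.\<close>
      have "\<exists>y z. y < Suc n \<and> y \<notin> j ` {..<m} \<and> z < Suc m \<and> z \<notin> k ` {..<l} \<and> (j(m := y)) z = w"
      proof (cases "w \<in> j ` {..<m}")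
        case True
        then obtain z where z: "z < m" "j z = w" by auto
        moreover have "z \<notin> k ` {..<l}" using w(2) z(2) by (auto simp: compose_def)
        moreover have "n \<notin> j ` {..<m}" using sub(1) by auto
        ultimately show ?thesis by (intro exI[of _ n] exI[of _ z]) auto
      next
        case False
        moreover have "m \<notin> k ` {..<l}" using sub(2) by auto
        ultimately show ?thesis using w(1) by (intro exI[of _ w] exI[of _ m]) auto
      qed
      then obtain y z where yz: "y < Suc n" "y \<notin> j ` {..<m}" "z < Suc m" "z \<notin> k ` {..<l}" "(j(m := y)) z = w"
        by blast
      have "hproj ar \<beta> (Suc m) (Suc n) \<theta> (j(m := y)) \<in> ext ar (hproj ar \<alpha> m n \<phi> j)"
        unfolding ext_hproj(2)[OF P j succ] using \<theta> yz(1,2) by blast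
      then show "x \<in> ?A"
        unfolding x upd[OF \<theta> yz(1-4), unfolded yz(5), symmetric] using yz(3,4) by blast
    qed
    then have ext: "ext ar (hproj ar \<alpha> l m (hproj ar \<alpha> m n \<phi> j) k) = ext ar (hproj ar \<alpha> l n \<phi> (compose {..<l} j k))"
      unfolding ext_hproj(2)[OF Psi_hproj[OF P j] k succ] ext_hproj(2)[OF P jk succ] .
    have "first_conj ar (hproj ar \<alpha> l m (hproj ar \<alpha> m n \<phi> j) k) = first_conj ar (hproj ar \<alpha> l n \<phi> (compose {..<l} j k))"
      unfolding ext_hproj(1)[OF Psi_hproj[OF P j] k succ] ext_hproj(1)[OF P jk succ] ext_hproj(1)[OF P j succ]
      by (rule less.IH[OF lt Psi_succE(1)[where ar=ar and r=r, OF ar P succ] j k])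
    with ext show ?thesis
      using Psi_succE(4)[where ar=ar and r=r, OF ar Psi_hproj[OF Psi_hproj[OF P j] k] succ]
        Psi_succE(4)[where ar=ar and r=r, OF ar Psi_hproj[OF P jk] succ] by simp
  next
    case limit
    have "hproj ar \<beta> l m (vproj ar \<beta> \<alpha> (hproj ar \<alpha> m n \<phi> j)) k =
        hproj ar \<beta> l n (vproj ar \<beta> \<alpha> \<phi>) (compose {..<l} j k)" if "\<beta> < \<alpha>" for \<beta>
      using less.IH[OF that Psi_vproj[where ar=ar and r=r, OF ar P] j k] vproj_hproj[OF P j] that by simp
    then show ?thesis
      unfolding hproj_limit[OF limit, of ar l]
      by (intro arg_cong[of _ _ Conj] image_cong) auto
  qed
qed

end

section \<open>Scott processes\<close>

lemma injections_extend:
  assumes "j \<in> injections m n"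
  obtains k where "k \<in> injections n n" "compose {..<m} k (incl m) = j"
proof -
  have inj: "inj_on j {..<m}" and im: "j ` {..<m} \<subseteq> {..<n}" and ext: "j \<in> extensional {..<m}"
    using assms injections_image by (auto simp: injections_def PiE_iff)
  note le = injections_le[OF assms]
  \<comment> \<open>The two complements have equal size, so \<open>j\<close> can be completed to a
    permutation. This later reduces projection along \<open>j\<close> to a permutation followed by a
    truncation.\<close>
  have "card {m..<n} = card ({..<n} - j ` {..<m})"
    using card_image[OF inj] im by (simp add: card_Diff_subset)
  then obtain h where h: "bij_betw h {m..<n} ({..<n} - j ` {..<m})"
    using finite_same_card_bij by blast
  have him: "h i < n" "h i \<notin> j ` {..<m}" if "i < n" "\<not> i < m" for i
  proof -
    have "h i \<in> {..<n} - j ` {..<m}"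
      using bij_betwE[OF h] that by simp
    then show "h i < n" "h i \<notin> j ` {..<m}" by auto
  qed
  define k where "k = (\<lambda>i\<in>{..<n}. if i < m then j i else h i)"
  have "k \<in> {..<n} \<rightarrow>\<^sub>E {..<n}"
    using him(1) im by (fastforce simp: k_def)
  moreover have "inj_on k {..<n}"
  proof (rule inj_onI)
    fix x y assume xy: "x \<in> {..<n}" "y \<in> {..<n}" "k x = k y"
    show "x = y"
    proof (cases "x < m"; cases "y < m")
      assume "x < m" "y < m"
      then show ?thesis using xy inj by (auto simp: k_def inj_on_def)
    next
      assume "x < m" "\<not> y < m"
      then show ?thesis using xy him(2)[of y] by (simp add: k_def) (metis imageI lessThan_iff)
    next
      assume "\<not> x < m" "y < m"
      then show ?thesis using xy him(2)[of x] by (simp add: k_def)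
    next
      assume "\<not> x < m" "\<not> y < m"
      then show ?thesis using xy h by (auto simp: k_def bij_betw_def inj_on_def)
    qed
  qed
  ultimately have "k \<in> injections n n" by (simp add: injections_def)
  moreover have "compose {..<m} k (incl m) = j"
    using le ext by (auto simp: compose_def incl_def k_def fun_eq_iff extensional_def)
  ultimately show thesis by (rule that)
qed

text \<open>If \<open>\<delta>\<close> has uncountable cofinality, countably many points are already separated at one stage
  below \<open>\<delta>\<close>; otherwise the separating stages are cofinal.\<close>

lemma countable_separating_ordinals:
  fixes f :: "'o::wellorder \<Rightarrow> 'a \<Rightarrow> 'b"
  assumes "countable X"
    and mono: "\<And>\<alpha> \<beta> x y. \<alpha> \<le> \<beta> \<Longrightarrow> \<beta> < \<delta> \<Longrightarrow> x \<in> X \<Longrightarrow> y \<in> X \<Longrightarrow> f \<beta> x = f \<beta> y \<Longrightarrow> f \<alpha> x = f \<alpha> y"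
  obtains B where "countable B" "B \<subseteq> {..<\<delta>}"
    "\<And>\<alpha>. \<alpha> < \<delta> \<Longrightarrow> \<exists>\<beta>\<in>B. \<forall>x\<in>X. \<forall>y\<in>X. f \<beta> x = f \<beta> y \<longrightarrow> f \<alpha> x = f \<alpha> y"
proof -
  define s where "s p = (SOME \<gamma>. \<gamma> < \<delta> \<and> f \<gamma> (fst p) \<noteq> f \<gamma> (snd p))" for p
  have s: "s (x, y) < \<delta>" "f (s (x, y)) x \<noteq> f (s (x, y)) y" if "\<gamma> < \<delta>" "f \<gamma> x \<noteq> f \<gamma> y" for x y \<gamma>
    using someI[of "\<lambda>\<gamma>. \<gamma> < \<delta> \<and> f \<gamma> x \<noteq> f \<gamma> y" \<gamma>] that by (auto simp: s_def)
  \<comment> \<open>For a pair that no stage separates, the choice \<open>s\<close> is arbitrary;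
    the intersection discards any such value that is not below \<delta>.\<close>
  define S where "S = s ` (X \<times> X) \<inter> {..<\<delta>}"
  have S: "countable S" using assms(1) by (simp add: S_def)
  show thesis
  proof (cases "\<exists>b<\<delta>. \<forall>\<gamma>\<in>S. \<gamma> \<le> b")
    case True
    then obtain b where b: "b < \<delta>" "\<forall>\<gamma>\<in>S. \<gamma> \<le> b" by blast
    \<comment> \<open>If \<open>x\<close> and \<open>y\<close> are separated at all, they are
      separated at a stage up to \<open>b\<close>; agreement at \<open>b\<close> would pass down to
      that stage.\<close>
    have *: "f \<alpha> x = f \<alpha> y" if "\<alpha> < \<delta>" "x \<in> X" "y \<in> X" "f b x = f b y" for \<alpha> x y
    proof (rule ccontr)
      assume "f \<alpha> x \<noteq> f \<alpha> y"
      note s = s[OF that(1) this]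
      then have "s (x, y) \<le> b" using b(2) that by (auto simp: S_def)
      then show False using mono[OF _ b(1) that(2-4)] s(2) by blast
    qed
    show ?thesis
    proof (rule that[of "{b}"])
      show "\<exists>\<beta>\<in>{b}. \<forall>x\<in>X. \<forall>y\<in>X. f \<beta> x = f \<beta> y \<longrightarrow> f \<alpha> x = f \<alpha> y" if "\<alpha> < \<delta>" for \<alpha>
        using *[OF that] by blast
    qed (use b(1) in auto)
  next
    case False
    have "\<exists>\<beta>\<in>S. \<forall>x\<in>X. \<forall>y\<in>X. f \<beta> x = f \<beta> y \<longrightarrow> f \<alpha> x = f \<alpha> y" if "\<alpha> < \<delta>" for \<alpha>
    proof -
      from False that obtain \<beta> where \<beta>: "\<beta> \<in> S" "\<alpha> \<le> \<beta>" by (meson linear)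
      then have "\<beta> < \<delta>" by (simp add: S_def)
      then show ?thesis using mono[OF \<beta>(2)] \<beta>(1) by blast
    qed
    then show ?thesis
      by (rule that[OF S, rotated]) (simp_all add: S_def)
  qed
qed

text \<open>This is the Rasiowa-Sikorski argument: the countably many dense sets are enumerated,
  possibly with repetition, and dependent choice enters the \<open>k\<close>-th one at step
  \<open>Suc k\<close>. Nonemptiness makes every index of the enumeration denote a member of
  \<D>.\<close>

lemma generic_sequence:
  assumes "countable \<D>" "x0 \<in> P"
    and dense: "\<And>D x. D \<in> \<D> \<Longrightarrow> x \<in> P \<Longrightarrow> \<exists>y\<in>P. le x y \<and> y \<in> D"
    and "\<D> \<noteq> {}"
  obtains p :: "nat \<Rightarrow> 'a" where "\<And>k. p k \<in> P" "\<And>k. le (p k) (p (Suc k))" "\<And>D. D \<in> \<D> \<Longrightarrow> \<exists>k. p k \<in> D"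
proof -
  have "\<exists>p. \<forall>k. p k \<in> P \<and> (le (p k) (p (Suc k)) \<and> p (Suc k) \<in> from_nat_into \<D> k)"
    using assms(2) dense[OF from_nat_into[OF assms(4)]] by (intro dependent_nat_choice) blast+
  then obtain p where p: "\<And>k. p k \<in> P" "\<And>k. le (p k) (p (Suc k))" "\<And>k. p (Suc k) \<in> from_nat_into \<D> k"
    by blast
  have "\<exists>k. p k \<in> D" if "D \<in> \<D>" for D
    using from_nat_into_surj[OF assms(1) that] p(3) by metis
  with p show thesis using that by blast
qed

text \<open>A list without repetitions becomes an injection of indices, restricted so that it is
  extensional like the members of \<open>injections\<close>. Tuples can thus serve as arguments of
  \<open>hproj\<close>.\<close>

definition embedding :: "nat list \<Rightarrow> nat \<Rightarrow> nat" where
  "embedding a = (\<lambda>i\<in>{..<length a}. a ! i)"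

lemma embedding_injections:
  assumes "distinct a" "set a \<subseteq> {..<n}"
  shows "embedding a \<in> injections (length a) n"
proof -
  have "a ! i < n" if "i < length a" for i
    using nth_mem[OF that] assms(2) by auto
  then show ?thesis
    using assms(1) by (simp add: embedding_def injections_def inj_on_def nth_eq_iff_index_eq)
qed

lemma embedding_image: "embedding a ` {..<length a} = set a"
proof -
  have "embedding a ` {..<length a} = (!) a ` {..<length a}"
    by (intro image_cong) (auto simp: embedding_def)
  then show ?thesis using nth_image[of "length a" a] by (simp add: atLeast0LessThan)
qed

text \<open>Appending an element is the update by which \<open>hproj\<close> treats a new variable
  at successor levels.\<close>

lemma embedding_append: "embedding (a @ [c]) = (embedding a)(length a := c)"
proof
  show "embedding (a @ [c]) i = ((embedding a)(length a := c)) i" for i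
    by (cases i "length a" rule: linorder_cases) (simp_all add: embedding_def nth_append)
qed

lemma compose_embedding:
  assumes "j \<in> injections m (length a)"
  shows "compose {..<m} (embedding a) j = embedding (map (\<lambda>i. a ! j i) [0..<m])"
proof
  show "compose {..<m} (embedding a) j i = embedding (map (\<lambda>i. a ! j i) [0..<m]) i" for i
    using injections_image[OF assms] by (cases "i < m") (auto simp: compose_def embedding_def)
qed

lemma embedding_map:
  assumes "j \<in> injections m n"
  shows "embedding (map j [0..<m]) = j" "distinct (map j [0..<m])" "set (map j [0..<m]) \<subseteq> {..<n}"
proof -
  have j: "inj_on j {..<m}" "j \<in> extensional {..<m}"
    using assms by (simp_all add: injections_def PiE_def)
  show "embedding (map j [0..<m]) = j"
  proof
    show "embedding (map j [0..<m]) i = j i" for i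
      using j(2) by (cases "i < m") (simp_all add: embedding_def extensional_def)
  qed
  show "distinct (map j [0..<m])" "set (map j [0..<m]) \<subseteq> {..<n}"
    using j(1) injections_image[OF assms] by (simp_all add: distinct_map atLeast0LessThan)
qed

section \<open>Closure and extension properties of a fixed process\<close>

context
  fixes ar :: "'r \<Rightarrow> nat" and r and \<delta> :: "'o::wellorder" and \<Phi> :: "'o \<Rightarrow> ('r, 'o, 'k) formula set"
  assumes ar: "ar r = 0" and process: "scott_process ar {..\<delta>} \<Phi>"
begin

lemmas conditions = process[unfolded scott_process_def]
lemmas condition_1a = conditions[THEN conjunct2, THEN conjunct1]
lemmas condition_1c = conditions[THEN conjunct2, THEN conjunct2, THEN conjunct2, THEN conjunct1]
lemmas condition_1d = conditions[THEN conjunct2, THEN conjunct2, THEN conjunct2, THEN conjunct2,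
    THEN conjunct1]
lemmas condition_1e = conditions[THEN conjunct2, THEN conjunct2, THEN conjunct2, THEN conjunct2,
    THEN conjunct2, THEN conjunct1]
lemmas condition_2a = conditions[THEN conjunct2, THEN conjunct2, THEN conjunct2, THEN conjunct2,
    THEN conjunct2, THEN conjunct2, THEN conjunct1]
lemmas condition_2b = conditions[THEN conjunct2, THEN conjunct2, THEN conjunct2, THEN conjunct2,
    THEN conjunct2, THEN conjunct2, THEN conjunct2, THEN conjunct1]
lemmas condition_2c = conditions[THEN conjunct2, THEN conjunct2, THEN conjunct2, THEN conjunct2,
    THEN conjunct2, THEN conjunct2, THEN conjunct2, THEN conjunct2]

lemma sliceD: "\<phi> \<in> slice ar \<Phi> \<alpha> n \<Longrightarrow> Psi ar \<alpha> n \<phi>" "\<phi> \<in> slice ar \<Phi> \<alpha> n \<Longrightarrow> \<phi> \<in> \<Phi> \<alpha>"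
  by (auto simp: slice_def)

lemma slice_exists: "\<phi> \<in> \<Phi> \<alpha> \<Longrightarrow> \<alpha> \<le> \<delta> \<Longrightarrow> \<exists>n. \<phi> \<in> slice ar \<Phi> \<alpha> n"
  using condition_1a by (auto simp: slice_def)

lemma level_vproj: "\<alpha> \<le> \<beta> \<Longrightarrow> \<beta> \<le> \<delta> \<Longrightarrow> \<Phi> \<alpha> = vproj ar \<alpha> \<beta> ` \<Phi> \<beta>"
  using condition_1c by (cases "\<alpha> = \<beta>") (simp_all add: order.strict_iff_order)

lemma slice_vproj: "\<phi> \<in> slice ar \<Phi> \<beta> n \<Longrightarrow> \<alpha> \<le> \<beta> \<Longrightarrow> \<beta> \<le> \<delta> \<Longrightarrow> vproj ar \<alpha> \<beta> \<phi> \<in> slice ar \<Phi> \<alpha> n"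
  using level_vproj[of \<alpha> \<beta>] Psi_vproj[where ar=ar and r=r, OF ar, of \<beta> n \<phi> \<alpha>] by (auto simp: slice_def)

lemma slice_incl:
  assumes "\<alpha> \<le> \<delta>" "m < n"
  shows "slice ar \<Phi> \<alpha> m = (\<lambda>\<phi>. hproj ar \<alpha> m n \<phi> (incl m)) ` slice ar \<Phi> \<alpha> n"
  using condition_1e assms by simp

text \<open>A permutation first brings the range of \<open>j\<close> to the front and a truncation
  follows; \<open>condition_1d\<close> and \<open>condition_1e\<close> cover these two
  steps.\<close>

lemma slice_hproj:
  assumes "\<phi> \<in> slice ar \<Phi> \<alpha> n" "\<alpha> \<le> \<delta>" "j \<in> injections m n"
  shows "hproj ar \<alpha> m n \<phi> j \<in> slice ar \<Phi> \<alpha> m"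
proof -
  have perm: "hproj ar \<alpha> n n \<phi> k \<in> slice ar \<Phi> \<alpha> n" if "k \<in> injections n n" for k
    using condition_1d assms(1,2) that by blast
  show ?thesis
  proof (cases "m = n")
    case True
    then show ?thesis using perm assms(3) by simp
  next
    case False
    then have lt: "m < n" using injections_le[OF assms(3)] by simp
    obtain k where k: "k \<in> injections n n" "compose {..<m} k (incl m) = j"
      using injections_extend[OF assms(3)] .
    have "hproj ar \<alpha> m n (hproj ar \<alpha> n n \<phi> k) (incl m) = hproj ar \<alpha> m n \<phi> j"
      using hproj_hproj[where ar=ar and r=r, OF ar sliceD(1)[OF assms(1)] k(1) incl_injections, of m] k(2) lt by simp
    then show ?thesis
      using imageI[OF perm[OF k(1)], of "\<lambda>\<phi>. hproj ar \<alpha> m n \<phi> (incl m)"] slice_incl[OF assms(2) lt]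
      by simp
  qed
qed

text \<open>By \<open>condition_1e\<close>, truncation carries elements to smaller arities and,
  being surjective, also provides preimages in larger ones.\<close>

lemma slice_nonempty:
  assumes "\<Phi> \<delta> \<noteq> {}"
  shows "slice ar \<Phi> \<delta> n \<noteq> {}"
proof -
  obtain m where m: "slice ar \<Phi> \<delta> m \<noteq> {}" using assms slice_exists by blast
  show ?thesis
    using slice_incl[of \<delta> m n] slice_incl[of \<delta> n m] m by (cases n m rule: linorder_cases) auto
qed

text \<open>At level \<gamma> the projection of \<rho> still extends that of its truncation, so
  \<open>condition_2a\<close> applies there; its projection one step further down is that of
  \<rho>.\<close>

lemma vproj_ext:
  assumes "\<rho> \<in> slice ar \<Phi> \<delta> (Suc m)" "is_succ \<beta> \<gamma>" "\<gamma> \<le> \<delta>"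
  shows "vproj ar \<beta> \<delta> \<rho> \<in> ext ar (vproj ar \<gamma> \<delta> (hproj ar \<delta> m (Suc m) \<rho> (incl m)))"
proof -
  note i = incl_injections[of m "Suc m", simplified]
  note P = sliceD(1)[OF assms(1)]
  let ?\<phi> = "vproj ar \<gamma> \<delta> (hproj ar \<delta> m (Suc m) \<rho> (incl m))"
  have "?\<phi> \<in> slice ar \<Phi> \<gamma> m"
    using slice_vproj[OF slice_hproj[OF assms(1) order_refl i] assms(3)] by simp
  then have "ext ar ?\<phi> = vproj ar \<beta> \<gamma> `
      {\<psi> \<in> slice ar \<Phi> \<gamma> (Suc m). hproj ar \<gamma> m (Suc m) \<psi> (incl m) = ?\<phi>}"
    using condition_2a assms(2,3) by simp
  moreover have "hproj ar \<gamma> m (Suc m) (vproj ar \<gamma> \<delta> \<rho>) (incl m) = ?\<phi>"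
    using vproj_hproj[where ar=ar and r=r, OF ar P i assms(3)] by simp
  moreover have "vproj ar \<gamma> \<delta> \<rho> \<in> slice ar \<Phi> \<gamma> (Suc m)"
    using slice_vproj[OF assms(1) assms(3)] by simp
  moreover have "vproj ar \<beta> \<gamma> (vproj ar \<gamma> \<delta> \<rho>) = vproj ar \<beta> \<delta> \<rho>"
    using vproj_vproj[where ar=ar and r=r, OF ar P] is_succ_less[OF assms(2)] assms(3) by simp
  ultimately show ?thesis by (metis (mono_tags, lifting) image_eqI mem_Collect_eq)
qed

text \<open>The counterpart of \<open>vproj_ext\<close>: by \<open>condition_2b\<close>, an
  extension known only at level \<beta> lifts to an extension of \<phi> itself at level
  \<delta>.\<close>

lemma ext_vproj:
  assumes "\<phi> \<in> slice ar \<Phi> \<delta> m" "is_succ \<beta> \<gamma>" "\<gamma> \<le> \<delta>" "\<psi> \<in> ext ar (vproj ar \<gamma> \<delta> \<phi>)"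
  obtains \<rho> where "\<rho> \<in> slice ar \<Phi> \<delta> (Suc m)" "hproj ar \<delta> m (Suc m) \<rho> (incl m) = \<phi>" "\<psi> = vproj ar \<beta> \<delta> \<rho>"
proof -
  have "ext ar (vproj ar \<gamma> \<delta> \<phi>) \<subseteq> vproj ar \<beta> \<delta> `
          {\<psi> \<in> slice ar \<Phi> \<delta> (Suc m). hproj ar \<delta> m (Suc m) \<psi> (incl m) = \<phi>}"
    using condition_2b assms(1-3) by simp
  then show thesis using assms(4) that by blast
qed

text \<open>The projection of \<rho> to \<beta> lies in the \<open>ext\<close> set of a projection
  along \<open>j\<close> at the successor level \<gamma>. The successor clause of
  \<open>hproj\<close> then names an extension of \<theta> at level \<beta> and a variable, old or
  new, that realizes it. \<open>condition_2b\<close> lifts this extension to \<delta>, so agreement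
  with \<rho> is controlled only at level \<beta>.\<close>

lemma realize_below:
  assumes \<theta>: "\<theta> \<in> slice ar \<Phi> \<delta> n" and j: "j \<in> injections m n" and \<rho>: "\<rho> \<in> slice ar \<Phi> \<delta> (Suc m)"
    and eq: "hproj ar \<delta> m (Suc m) \<rho> (incl m) = hproj ar \<delta> m n \<theta> j" and "\<beta> < \<delta>"
  obtains \<theta>' y where "\<theta>' \<in> slice ar \<Phi> \<delta> (Suc n)" "hproj ar \<delta> n (Suc n) \<theta>' (incl n) = \<theta>"
    "y < Suc n" "y \<notin> j ` {..<m}"
    "vproj ar \<beta> \<delta> (hproj ar \<delta> (Suc m) (Suc n) \<theta>' (j(m := y))) = vproj ar \<beta> \<delta> \<rho>"
proof -
  obtain \<gamma> where \<gamma>: "is_succ \<beta> \<gamma>" "\<gamma> \<le> \<delta>" using is_succ_exists[OF assms(5)] .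
  note P = sliceD(1)[OF \<theta>]
  have "vproj ar \<beta> \<delta> \<rho> \<in> ext ar (hproj ar \<gamma> m n (vproj ar \<gamma> \<delta> \<theta>) j)"
    using vproj_ext[OF \<rho> \<gamma>] vproj_hproj[where ar=ar and r=r, OF ar P j \<gamma>(2)] eq by simp
  then obtain \<psi> y where y: "\<psi> \<in> ext ar (vproj ar \<gamma> \<delta> \<theta>)" "y < Suc n" "y \<notin> j ` {..<m}"
      "vproj ar \<beta> \<delta> \<rho> = hproj ar \<beta> (Suc m) (Suc n) \<psi> (j(m := y))"
    using ext_hproj(2)[where ar=ar and r=r, OF ar Psi_vproj[where ar=ar and r=r, OF ar P \<gamma>(2)] j \<gamma>(1)]
    by auto
  obtain \<theta>' where \<theta>': "\<theta>' \<in> slice ar \<Phi> \<delta> (Suc n)" "hproj ar \<delta> n (Suc n) \<theta>' (incl n) = \<theta>"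
      "\<psi> = vproj ar \<beta> \<delta> \<theta>'"
    using ext_vproj[OF \<theta> \<gamma> y(1)] .
  have "vproj ar \<beta> \<delta> (hproj ar \<delta> (Suc m) (Suc n) \<theta>' (j(m := y))) = vproj ar \<beta> \<delta> \<rho>"
    using vproj_hproj[where ar=ar and r=r, OF ar sliceD(1)[OF \<theta>'(1)] injections_update[OF j y(2,3)], of \<beta>]
      y(4) \<theta>'(3) assms(5) by simp
  then show thesis using that \<theta>' y(2,3) by blast
qed

lemma amalgamate:
  assumes "\<phi> \<in> slice ar \<Phi> \<delta> n" "\<psi> \<in> slice ar \<Phi> \<delta> m"
  obtains \<theta> j where "\<theta> \<in> slice ar \<Phi> \<delta> (n + m)" "j \<in> injections m (n + m)"
    "hproj ar \<delta> n (n + m) \<theta> (incl n) = \<phi>" "hproj ar \<delta> m (n + m) \<theta> j = \<psi>"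
proof -
  have "\<exists>\<theta>\<in>slice ar \<Phi> \<delta> (n + m). \<exists>j\<in>injections m (n + m).
          \<phi> = hproj ar \<delta> n (n + m) \<theta> (incl n) \<and> \<psi> = hproj ar \<delta> m (n + m) \<theta> j"
    using condition_2c assms by simp
  then show thesis using that by blast
qed

section \<open>The generic chain and the formulas of tuples\<close>

lemma hproj_incl_trans:
  assumes "Psi ar \<delta> n (\<theta> :: ('r, 'o, 'k) formula)" "j \<in> injections l m" "m \<le> n"
  shows "hproj ar \<delta> l m (hproj ar \<delta> m n \<theta> (incl m)) j = hproj ar \<delta> l n \<theta> j"
  using hproj_hproj[where ar=ar and r=r, OF ar assms(1) incl_injections[OF assms(3)] assms(2)]
    compose_incl[OF assms(2)] by simp

lemma extend_slice:
  assumes "\<theta> \<in> slice ar \<Phi> \<delta> n" "n < N"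
  obtains \<theta>' where "\<theta>' \<in> slice ar \<Phi> \<delta> N" "hproj ar \<delta> n N \<theta>' (incl n) = \<theta>"
proof -
  have "\<theta> \<in> (\<lambda>\<phi>. hproj ar \<delta> n N \<phi> (incl n)) ` slice ar \<Phi> \<delta> N"
    using assms slice_incl[of \<delta> n N] by simp
  then show thesis by (rule imageE) (rule that, simp_all)
qed

text \<open>A generic sequence of pairs of an arity and a formula of that arity in
  \<open>\<Phi> \<delta>\<close>, ordered by extension. The dense sets make the arity reach any
  bound, make each formula occur, and provide a witness for each tuple, each candidate extension
  \<rho> and each \<beta> in \<open>B\<close>; countability of \<open>\<Phi> \<delta>\<close> and
  \<open>B\<close> keeps their number countable.\<close>

lemma generic_chain:
  assumes "countable (\<Phi> \<delta>)" "\<Phi> \<delta> \<noteq> {}" "countable B" "B \<subseteq> {..<\<delta>}"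
  obtains n \<theta> where "\<And>k. \<theta> k \<in> slice ar \<Phi> \<delta> (n k)"
    "\<And>k. n k \<le> n (Suc k)" "\<And>k. hproj ar \<delta> (n k) (n (Suc k)) (\<theta> (Suc k)) (incl (n k)) = \<theta> k"
    "\<And>N. \<exists>k. N \<le> n k"
    "\<And>m \<phi>. \<phi> \<in> slice ar \<Phi> \<delta> m \<Longrightarrow> \<exists>k. \<exists>j\<in>injections m (n k). hproj ar \<delta> m (n k) (\<theta> k) j = \<phi>"
    "\<And>a \<rho> \<beta>. distinct a \<Longrightarrow> \<rho> \<in> slice ar \<Phi> \<delta> (Suc (length a)) \<Longrightarrow> \<beta> \<in> B \<Longrightarrow>
       \<exists>k. set a \<subseteq> {..<n k} \<and>
         (hproj ar \<delta> (length a) (Suc (length a)) \<rho> (incl (length a)) = hproj ar \<delta> (length a) (n k) (\<theta> k) (embedding a) \<longrightarrow>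
           (\<exists>c<n k. c \<notin> set a \<and>
             vproj ar \<beta> \<delta> (hproj ar \<delta> (Suc (length a)) (n k) (\<theta> k) (embedding (a @ [c]))) = vproj ar \<beta> \<delta> \<rho>))"
proof -
  define P where "P = {x. snd x \<in> slice ar \<Phi> \<delta> (fst x)}"
  define le where "le x y \<longleftrightarrow> fst x \<le> fst y \<and> hproj ar \<delta> (fst x) (fst y) (snd y) (incl (fst x)) = snd x"
    for x y :: "nat \<times> ('r, 'o, 'k) formula"
  define occ where "occ m \<phi> = {x. \<phi> \<in> slice ar \<Phi> \<delta> m \<longrightarrow>
      (\<exists>j\<in>injections m (fst x). hproj ar \<delta> m (fst x) (snd x) j = \<phi>)}" for m \<phi>
  \<comment> \<open>The inclusion of \<open>a\<close> stands outside the innermost implication, so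
    that a stage in this set decides the formula of \<open>a\<close> and cannot satisfy the
    requirement by lacking some of its entries.\<close>
  define witnessed where "witnessed a \<rho> \<beta> = {x. distinct a \<longrightarrow> \<rho> \<in> slice ar \<Phi> \<delta> (Suc (length a)) \<longrightarrow>
      set a \<subseteq> {..<fst x} \<and>
         (hproj ar \<delta> (length a) (Suc (length a)) \<rho> (incl (length a)) = hproj ar \<delta> (length a) (fst x) (snd x) (embedding a) \<longrightarrow>
           (\<exists>c<fst x. c \<notin> set a \<and>
             vproj ar \<beta> \<delta> (hproj ar \<delta> (Suc (length a)) (fst x) (snd x) (embedding (a @ [c]))) = vproj ar \<beta> \<delta> \<rho>))}" for a \<rho> \<beta>
  define \<D> where "\<D> = range (\<lambda>N. {x. N \<le> fst x}) \<union> (\<lambda>(m, \<phi>). occ m \<phi>) ` (UNIV \<times> \<Phi> \<delta>) \<union>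
      (\<lambda>(a, \<rho>, \<beta>). witnessed a \<rho> \<beta>) ` (UNIV \<times> \<Phi> \<delta> \<times> B)"
  have unbounded_dense: "\<exists>y\<in>P. le x y \<and> N \<le> fst y" if "x \<in> P" for N x
  proof -
    \<comment> \<open>The outer \<open>Suc\<close> makes the new arity strictly larger, which
      \<open>extend_slice\<close> needs even if \<open>N\<close> is small.\<close>
    have "snd x \<in> slice ar \<Phi> \<delta> (fst x)" "fst x < Suc (max (fst x) N)"
      using that by (auto simp: P_def)
    then obtain \<theta>' where "\<theta>' \<in> slice ar \<Phi> \<delta> (Suc (max (fst x) N))"
        "hproj ar \<delta> (fst x) (Suc (max (fst x) N)) \<theta>' (incl (fst x)) = snd x"
      by (rule extend_slice)
    then show ?thesis
      by (intro bexI[of _ "(Suc (max (fst x) N), \<theta>')"]) (auto simp: P_def le_def)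
  qed
  have occ_dense: "\<exists>y\<in>P. le x y \<and> y \<in> occ m \<phi>" if "x \<in> P" for x m \<phi>
  proof (cases "\<phi> \<in> slice ar \<Phi> \<delta> m")
    case True
    have "snd x \<in> slice ar \<Phi> \<delta> (fst x)" using that by (auto simp: P_def)
    \<comment> \<open>Amalgamating with \<phi> keeps the current formula on the first variables, so
      the result lies above \<open>x\<close>.\<close>
    from this True obtain \<theta> j where "\<theta> \<in> slice ar \<Phi> \<delta> (fst x + m)" "j \<in> injections m (fst x + m)"
        "hproj ar \<delta> (fst x) (fst x + m) \<theta> (incl (fst x)) = snd x" "hproj ar \<delta> m (fst x + m) \<theta> j = \<phi>"
      by (rule amalgamate)
    then show ?thesis
      by (intro bexI[of _ "(fst x + m, \<theta>)"]) (auto simp: P_def le_def occ_def)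
  next
    case False
    then show ?thesis using unbounded_dense[OF that, of 0] by (auto simp: occ_def)
  qed
  have witnessed_dense: "\<exists>y\<in>P. le x y \<and> y \<in> witnessed a \<rho> \<beta>" if x: "x \<in> P" and \<beta>: "\<beta> < \<delta>" for x a \<rho> \<beta>
  proof -
    obtain N where N: "set a \<subseteq> {..<N}" using finite_nat_bounded[of "set a"] by auto
    obtain y where y: "y \<in> P" "le x y" "N \<le> fst y" using unbounded_dense[OF x] by blast
    have sy: "snd y \<in> slice ar \<Phi> \<delta> (fst y)" using y(1) by (simp add: P_def)
    have ay: "set a \<subseteq> {..<fst y}" using N y(3) by auto
    show ?thesis
    \<comment> \<open>Once the entries of \<open>a\<close> are present, its formula is settled: if
      the premises on \<rho> fail, \<open>y\<close> itself will do, and otherwise one more variable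
      suffices.\<close>
    proof (cases "distinct a \<and> \<rho> \<in> slice ar \<Phi> \<delta> (Suc (length a)) \<and>
        hproj ar \<delta> (length a) (Suc (length a)) \<rho> (incl (length a)) = hproj ar \<delta> (length a) (fst y) (snd y) (embedding a)")
      case False
      then have "y \<in> witnessed a \<rho> \<beta>" using ay by (simp add: witnessed_def)
      then show ?thesis using y by blast
    next
      case True
      then have a: "distinct a" and \<rho>: "\<rho> \<in> slice ar \<Phi> \<delta> (Suc (length a))" and
        eq: "hproj ar \<delta> (length a) (Suc (length a)) \<rho> (incl (length a)) = hproj ar \<delta> (length a) (fst y) (snd y) (embedding a)"
        by auto
      obtain \<theta> c where \<theta>: "\<theta> \<in> slice ar \<Phi> \<delta> (Suc (fst y))" "hproj ar \<delta> (fst y) (Suc (fst y)) \<theta> (incl (fst y)) = snd y"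
        and c: "c < Suc (fst y)" "c \<notin> embedding a ` {..<length a}"
        and v: "vproj ar \<beta> \<delta> (hproj ar \<delta> (Suc (length a)) (Suc (fst y)) \<theta> ((embedding a)(length a := c))) = vproj ar \<beta> \<delta> \<rho>"
        by (rule realize_below[OF sy embedding_injections[OF a ay] \<rho> eq \<beta>])
      have xy: "fst x \<le> fst y" using y(2) by (simp add: le_def)
      have "le x (Suc (fst y), \<theta>)"
        using y(2) \<theta>(2) hproj_incl_trans[OF sliceD(1)[OF \<theta>(1)] incl_injections[OF xy]]
        by (simp add: le_def)
      moreover have "(Suc (fst y), \<theta>) \<in> witnessed a \<rho> \<beta>"
        using c v ay by (auto simp: witnessed_def embedding_image embedding_append intro!: exI[of _ c])
      ultimately show ?thesis using \<theta>(1) by (intro bexI[of _ "(Suc (fst y), \<theta>)"]) (auto simp: P_def)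
    qed
  qed
  have dense: "\<exists>y\<in>P. le x y \<and> y \<in> D" if "D \<in> \<D>" "x \<in> P" for D x
  proof -
    from that(1) consider N where "D = {x. N \<le> fst x}" | m \<phi> where "D = occ m \<phi>"
      | a \<rho> \<beta> where "D = witnessed a \<rho> \<beta>" "\<beta> \<in> B"
      unfolding \<D>_def by auto
    then show ?thesis
    proof cases
      case (3 a \<rho> \<beta>)
      then have "\<beta> < \<delta>" using assms(4) by auto
      then show ?thesis unfolding 3(1) by (rule witnessed_dense[OF that(2)])
    qed (simp_all add: unbounded_dense[OF that(2)] occ_dense[OF that(2)])
  qed
  have "countable \<D>"
    unfolding \<D>_def using assms(1,3) by (intro countable_Un countable_image countable_SIGMA) auto
  moreover have "\<D> \<noteq> {}" by (auto simp: \<D>_def)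
  moreover obtain \<theta>0 where "\<theta>0 \<in> slice ar \<Phi> \<delta> 0" using slice_nonempty[OF assms(2)] by blast
  then have "(0, \<theta>0) \<in> P" by (simp add: P_def)
  ultimately obtain p where p: "\<And>k. p k \<in> P" "\<And>k. le (p k) (p (Suc k))" "\<And>D. D \<in> \<D> \<Longrightarrow> \<exists>k. p k \<in> D"
    using generic_sequence[of \<D> "(0, \<theta>0)" P le] dense by metis
  show thesis
  proof (rule that[of "snd \<circ> p" "fst \<circ> p"])
    show "\<exists>k. N \<le> (fst \<circ> p) k" for N
      using p(3)[of "{x. N \<le> fst x}"] by (auto simp: \<D>_def)
    show "\<exists>k. \<exists>j\<in>injections m ((fst \<circ> p) k). hproj ar \<delta> m ((fst \<circ> p) k) ((snd \<circ> p) k) j = \<phi>"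
      if \<phi>: "\<phi> \<in> slice ar \<Phi> \<delta> m" for m \<phi>
    proof -
      have "occ m \<phi> \<in> \<D>" 
        unfolding \<D>_def by (intro UnI1[OF UnI2] image_eqI[of _ _ "(m, \<phi>)"]) (auto intro: sliceD(2)[OF \<phi>])
      then obtain k where "p k \<in> occ m \<phi>" using p(3) by blast
      then show ?thesis using \<phi> by (auto simp: occ_def)
    qed
    show "\<exists>k. set a \<subseteq> {..<(fst \<circ> p) k} \<and>
         (hproj ar \<delta> (length a) (Suc (length a)) \<rho> (incl (length a)) = hproj ar \<delta> (length a) ((fst \<circ> p) k) ((snd \<circ> p) k) (embedding a) \<longrightarrow>
           (\<exists>c<(fst \<circ> p) k. c \<notin> set a \<and>
             vproj ar \<beta> \<delta> (hproj ar \<delta> (Suc (length a)) ((fst \<circ> p) k) ((snd \<circ> p) k) (embedding (a @ [c]))) = vproj ar \<beta> \<delta> \<rho>))"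
      if a: "distinct a" and \<rho>: "\<rho> \<in> slice ar \<Phi> \<delta> (Suc (length a))" and \<beta>: "\<beta> \<in> B" for a \<rho> \<beta>
    proof -
      have "witnessed a \<rho> \<beta> \<in> \<D>" using sliceD(2)[OF \<rho>] \<beta> 
        unfolding \<D>_def by (intro UnI2 image_eqI[of _ _ "(a, \<rho>, \<beta>)"]) auto
      then obtain k where "p k \<in> witnessed a \<rho> \<beta>" using p(3) by blast
      then show ?thesis using a \<rho> by (intro exI[of _ k]) (simp add: witnessed_def)
    qed
  qed (use p in \<open>simp_all add: P_def le_def\<close>)
qed

text \<open>The formula \<open>t a\<close> of a tuple is read off from any stage of a generic chain
  that contains \<open>a\<close>. The chain provides witnesses at the levels in a countable
  \<open>B\<close>, and the choice of \<open>B\<close> by separation extends this to all levels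
  below \<delta>.\<close>

lemma types_exist:
  assumes "countable (\<Phi> \<delta>)" "\<Phi> \<delta> \<noteq> {}"
  obtains t :: "nat list \<Rightarrow> ('r, 'o, 'k) formula" where
    "\<And>a. distinct a \<Longrightarrow> t a \<in> slice ar \<Phi> \<delta> (length a)"
    "\<And>a m j. distinct a \<Longrightarrow> j \<in> injections m (length a) \<Longrightarrow>
      hproj ar \<delta> m (length a) (t a) j = t (map (\<lambda>i. a ! j i) [0..<m])"
    "\<And>n \<phi>. \<phi> \<in> slice ar \<Phi> \<delta> n \<Longrightarrow> \<exists>a. distinct a \<and> length a = n \<and> t a = \<phi>"
    "\<And>a \<rho> \<alpha>. distinct a \<Longrightarrow> \<rho> \<in> slice ar \<Phi> \<delta> (Suc (length a)) \<Longrightarrow>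
      hproj ar \<delta> (length a) (Suc (length a)) \<rho> (incl (length a)) = t a \<Longrightarrow> \<alpha> < \<delta> \<Longrightarrow>
      \<exists>c. c \<notin> set a \<and> vproj ar \<alpha> \<delta> (t (a @ [c])) = vproj ar \<alpha> \<delta> \<rho>"
proof -
  \<comment> \<open>Equality of projections passes down to lower levels, as needed to separate the
    formulas of \<open>\<Phi> \<delta>\<close> by countably many levels.\<close>
  have mono: "vproj ar \<alpha> \<delta> x = vproj ar \<alpha> \<delta> y"
    if ab: "\<alpha> \<le> \<beta>" "\<beta> < \<delta>" "x \<in> \<Phi> \<delta>" "y \<in> \<Phi> \<delta>" "vproj ar \<beta> \<delta> x = vproj ar \<beta> \<delta> y" for \<alpha> \<beta> x y
  proof -
    have "vproj ar \<alpha> \<delta> z = vproj ar \<alpha> \<beta> (vproj ar \<beta> \<delta> z)" if z: "z \<in> \<Phi> \<delta>" for z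
    proof -
      obtain n where P: "Psi ar \<delta> n z" using slice_exists[OF z order_refl] sliceD(1) by blast
      show ?thesis
        using vproj_vproj[where ar=ar and r=r, OF ar P ab(1)] ab(2) by simp
    qed
    then show ?thesis using ab(3-5) by simp
  qed
  show thesis
  proof (rule countable_separating_ordinals[OF assms(1), of \<delta> "\<lambda>\<alpha>. vproj ar \<alpha> \<delta>"], fact mono)
    fix B
    assume B: "countable B" "B \<subseteq> {..<\<delta>}" and
    sep: "\<And>\<alpha>. \<alpha> < \<delta> \<Longrightarrow> \<exists>\<beta>\<in>B. \<forall>x\<in>\<Phi> \<delta>. \<forall>y\<in>\<Phi> \<delta>. vproj ar \<beta> \<delta> x = vproj ar \<beta> \<delta> y \<longrightarrow> vproj ar \<alpha> \<delta> x = vproj ar \<alpha> \<delta> y"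
    show thesis
    proof (rule generic_chain[OF assms B])
      fix n \<theta>
      assume \<theta>: "\<And>k. \<theta> k \<in> slice ar \<Phi> \<delta> (n k)" and n: "\<And>k. n k \<le> n (Suc k)"
    and step: "\<And>k. hproj ar \<delta> (n k) (n (Suc k)) (\<theta> (Suc k)) (incl (n k)) = \<theta> k"
    and unbounded: "\<And>N. \<exists>k. N \<le> n k"
    and occurs: "\<And>m \<phi>. \<phi> \<in> slice ar \<Phi> \<delta> m \<Longrightarrow> \<exists>k. \<exists>j\<in>injections m (n k). hproj ar \<delta> m (n k) (\<theta> k) j = \<phi>"
    and extends: "\<And>a \<rho> \<beta>. distinct a \<Longrightarrow> \<rho> \<in> slice ar \<Phi> \<delta> (Suc (length a)) \<Longrightarrow> \<beta> \<in> B \<Longrightarrow>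
       \<exists>k. set a \<subseteq> {..<n k} \<and>
         (hproj ar \<delta> (length a) (Suc (length a)) \<rho> (incl (length a)) = hproj ar \<delta> (length a) (n k) (\<theta> k) (embedding a) \<longrightarrow>
           (\<exists>c<n k. c \<notin> set a \<and>
             vproj ar \<beta> \<delta> (hproj ar \<delta> (Suc (length a)) (n k) (\<theta> k) (embedding (a @ [c]))) = vproj ar \<beta> \<delta> \<rho>))"
      have incl: "n k \<le> n k' \<and> hproj ar \<delta> m (n k') (\<theta> k') j = hproj ar \<delta> m (n k) (\<theta> k) j"
        if "k \<le> k'" "j \<in> injections m (n k)" for k k' m j
        using that(1)
      proof (induction k' rule: dec_induct)
        case (step k')
        have j: "j \<in> injections m (n k')"
          using that(2) step.IH unfolding injections_def by (auto simp: PiE_iff intro: order_less_le_trans)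
        show ?case
          using hproj_incl_trans[OF sliceD(1)[OF \<theta>] j n] step.IH n[of k'] \<open>\<And>k. hproj ar \<delta> (n k) (n (Suc k)) (\<theta> (Suc k)) (incl (n k)) = \<theta> k\<close>
          by simp
      qed simp
      \<comment> \<open>The choice of a stage is immaterial: of two stages containing
        \<open>a\<close>, one is earlier, and \<open>incl\<close> identifies the
        projections.\<close>
      define t where "t a = (let k = SOME k. set a \<subseteq> {..<n k} in hproj ar \<delta> (length a) (n k) (\<theta> k) (embedding a))" for a
      have t: "t a = hproj ar \<delta> (length a) (n k) (\<theta> k) (embedding a)"
        if a: "distinct a" "set a \<subseteq> {..<n k}" for a k
      proof -
        define k' where "k' = (SOME k. set a \<subseteq> {..<n k})"
        have k': "set a \<subseteq> {..<n k'}" unfolding k'_def using someI[of "\<lambda>k. set a \<subseteq> {..<n k}" k] a(2) by blast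
        have *: "t a = hproj ar \<delta> (length a) (n k') (\<theta> k') (embedding a)"
          by (simp add: t_def k'_def Let_def)
        show ?thesis
          using incl[OF _ embedding_injections[OF a]] incl[OF _ embedding_injections[OF a(1) k']]
          unfolding * by (metis nle_le)
      qed
      have bounded: "\<exists>k. set a \<subseteq> {..<n k}" for a
      proof -
        obtain N where "set a \<subseteq> {..<N}" using finite_nat_bounded[of "set a"] by auto
        moreover obtain k where "N \<le> n k" using unbounded by blast
        ultimately show ?thesis by (intro exI[of _ k]) auto
      qed
      have t_slice: "t a \<in> slice ar \<Phi> \<delta> (length a)" if a: "distinct a" for a
      proof -
        obtain k where k: "set a \<subseteq> {..<n k}" using bounded by blast
        show ?thesis unfolding t[OF a k]
          by (rule slice_hproj[OF \<theta> order_refl embedding_injections[OF a k]])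
      qed
      show thesis
      proof (rule that[of t])
        show "t a \<in> slice ar \<Phi> \<delta> (length a)" if "distinct a" for a
          by (rule t_slice[OF that])
        show "hproj ar \<delta> m (length a) (t a) j = t (map (\<lambda>i. a ! j i) [0..<m])"
          if a: "distinct a" and j: "j \<in> injections m (length a)" for a m j
        proof -
          obtain k where k: "set a \<subseteq> {..<n k}" using bounded by blast
          note e = embedding_injections[OF a k]
          note c = compose_injections[OF e j, unfolded compose_embedding[OF j]]
          let ?b = "map (\<lambda>i. a ! j i) [0..<m]"
          have "inj_on (\<lambda>i. a ! j i) {..<m}"
          proof (rule inj_onI)
            fix x y
            assume xy: "x \<in> {..<m}" "y \<in> {..<m}" "a ! j x = a ! j y"
            then have "j x < length a" "j y < length a"
              using injections_image[OF j] by auto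
            then have "j x = j y" using a xy(3) by (simp add: nth_eq_iff_index_eq)
            then show "x = y" using j xy by (auto simp: injections_def dest: inj_onD)
          qed
          then have b: "distinct ?b" by (simp add: distinct_map atLeast0LessThan)
          have sb: "set ?b \<subseteq> {..<n k}"
          proof -
            have "a ! j i \<in> set a" if "i < m" for i
              using injections_image[OF j] that by (intro nth_mem) auto
            then have "set ?b \<subseteq> set a" by auto
            then show ?thesis using k by (rule order_trans)
          qed
          show ?thesis
            unfolding t[OF a k] t[OF b sb]
            using hproj_hproj[where ar=ar and r=r, OF ar sliceD(1)[OF \<theta>] e j] compose_embedding[OF j] by simp
        qed
        show "\<exists>a. distinct a \<and> length a = m \<and> t a = \<phi>" if \<phi>: "\<phi> \<in> slice ar \<Phi> \<delta> m" for m \<phi>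
        proof -
          obtain k j where j: "j \<in> injections m (n k)" "hproj ar \<delta> m (n k) (\<theta> k) j = \<phi>"
            using occurs[OF \<phi>] by blast
          then show ?thesis
            using t[OF embedding_map(2,3)[OF j(1)]] embedding_map[OF j(1)]
            by (intro exI[of _ "map j [0..<m]"]) simp
        qed
        show "\<exists>c. c \<notin> set a \<and> vproj ar \<alpha> \<delta> (t (a @ [c])) = vproj ar \<alpha> \<delta> \<rho>"
          if a: "distinct a" and \<rho>: "\<rho> \<in> slice ar \<Phi> \<delta> (Suc (length a))"
            and eq: "hproj ar \<delta> (length a) (Suc (length a)) \<rho> (incl (length a)) = t a" and \<alpha>: "\<alpha> < \<delta>" for a \<rho> \<alpha>
        proof -
          \<comment> \<open>At this level in \<open>B\<close>, agreement forces agreement at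
            \<alpha>, and the chain provides a witness for \<rho>.\<close>
          obtain \<beta> where \<beta>: "\<beta> \<in> B" and sep: "\<forall>x\<in>\<Phi> \<delta>. \<forall>y\<in>\<Phi> \<delta>. vproj ar \<beta> \<delta> x = vproj ar \<beta> \<delta> y \<longrightarrow> vproj ar \<alpha> \<delta> x = vproj ar \<alpha> \<delta> y"
            using sep[OF \<alpha>] by blast
          obtain k where k: "set a \<subseteq> {..<n k}" and
            k': "hproj ar \<delta> (length a) (Suc (length a)) \<rho> (incl (length a)) = hproj ar \<delta> (length a) (n k) (\<theta> k) (embedding a) \<longrightarrow>
               (\<exists>c<n k. c \<notin> set a \<and>
                 vproj ar \<beta> \<delta> (hproj ar \<delta> (Suc (length a)) (n k) (\<theta> k) (embedding (a @ [c]))) = vproj ar \<beta> \<delta> \<rho>)"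
            using extends[OF a \<rho> \<beta>] by blast
          obtain c where c: "c < n k" "c \<notin> set a" and
            v: "vproj ar \<beta> \<delta> (hproj ar \<delta> (Suc (length a)) (n k) (\<theta> k) (embedding (a @ [c]))) = vproj ar \<beta> \<delta> \<rho>"
            using k' unfolding eq t[OF a k] by blast
          have d: "distinct (a @ [c])" "set (a @ [c]) \<subseteq> {..<n k}" using a c k by auto
          have "vproj ar \<beta> \<delta> (t (a @ [c])) = vproj ar \<beta> \<delta> \<rho>"
            using v unfolding t[OF d] by simp
          then show ?thesis
            using sep sliceD(2)[OF t_slice[OF d(1)]] sliceD(2)[OF \<rho>] c(2) by blast
        qed
      qed
    qed
  qed
qed

end

section \<open>The model\<close>

lemma scott_fm_zero: "is_zero \<alpha> \<Longrightarrow> scott_fm ar M \<alpha> a = diagram ar (length a) {p. sat_atom M a p}"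
  by (subst scott_fm.simps) simp

lemma scott_fm_succ:
  assumes "is_succ \<beta> \<alpha>"
  shows "scott_fm ar M \<alpha> a = succ_fm (length a) (scott_fm ar M \<beta> a)
    ((\<lambda>c. scott_fm ar M \<beta> (a @ [c])) ` (univ M - set a))"
  using assms ordinal_kinds(4)[OF assms] by (subst scott_fm.simps) (auto simp: opred_eq)

lemma scott_fm_limit:
  "is_limit \<alpha> \<Longrightarrow> scott_fm ar M \<alpha> a = Conj ((\<lambda>\<beta>. scott_fm ar M \<beta> a) ` {..<\<alpha>})"
  by (subst scott_fm.simps) (auto simp: is_limit_def)

lemma Atom_diagram:
  "p \<in> atoms ar n \<Longrightarrow> Atom p \<in> conjuncts (diagram ar n S :: ('r, 'o, 'k) formula) \<longleftrightarrow> p \<in> S"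
  unfolding conjuncts_diagram by (auto simp: fm_simps)

text \<open>The atomic formula with arguments \<open>xs\<close> is decided by the type of any \<open>[0..<n]\<close> that contains \<open>xs\<close>.\<close>

definition type_model ::
  "('r \<Rightarrow> nat) \<Rightarrow> (nat list \<Rightarrow> ('r, 'o::wellorder, 'k) formula) \<Rightarrow> ('r, nat) struct" where
  "type_model ar D = \<lparr>univ = UNIV,
     interp = (\<lambda>R. {xs. length xs = ar R \<and> Atom (Rel R xs) \<in> conjuncts (D [0..<Suc (sum_list xs)])})\<rparr>"

text \<open>Every \<open>D b\<close> is a restriction of the diagram of a long initial segment
  \<open>[0..<n]\<close>, so all of them agree on common atoms. Hence the segment that
  \<open>type_model\<close> consults gives the same answer as \<open>a\<close>.\<close>

lemma sat_type_model:
  fixes D :: "nat list \<Rightarrow> ('r, 'o::wellorder, 'k) formula"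
  assumes "is_zero \<alpha>"
    and Psi: "\<And>a. distinct a \<Longrightarrow> Psi ar \<alpha> (length a) (D a)"
    and restrict: "\<And>a m j. distinct a \<Longrightarrow> j \<in> injections m (length a) \<Longrightarrow>
      diagram_proj m j (D a) = D (map (\<lambda>i. a ! j i) [0..<m])"
    and a: "distinct a"
  shows "diagram ar (length a) {p. sat_atom (type_model ar D) a p} = D a"
proof -
  have diag: "\<exists>S. (\<forall>i<length b. \<forall>k<length b. Eq i k \<in> S \<longleftrightarrow> i = k) \<and> D b = diagram ar (length b) S"
    if "distinct b" for b
    using Psi[OF that]
  proof cases
    case (zero S)
    then show ?thesis by blast
  next
    case (succ \<gamma> \<phi> E)
    then show ?thesis using ordinal_kinds(1)[OF assms(1)] by blast
  next
    case (limit \<psi>)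
    then show ?thesis using ordinal_kinds(2)[OF assms(1)] by blast
  qed
  \<comment> \<open>The diagram of \<open>b\<close> is the restriction of that of an initial segment
    along \<open>embedding b\<close>, so an atom is decided as its renamed version is there.\<close>
  have rename: "Atom p \<in> conjuncts (D b) \<longleftrightarrow> Atom (rename_atom (embedding b) p) \<in> conjuncts (D [0..<n])"
    if b: "distinct b" "set b \<subseteq> {..<n}" and p: "p \<in> atoms ar (length b)" for b n p
  proof -
    note j = embedding_injections[OF b]
    obtain S where S: "D [0..<n] = diagram ar n S" using diag[of "[0..<n]"] by auto
    have n: "embedding b i < n" if "i < length b" for i
      using injections_image[OF j] that by auto
    have "map (\<lambda>i. [0..<n] ! embedding b i) [0..<length b] = b"
      by (rule nth_equalityI) (use n in \<open>simp_all add: embedding_def\<close>)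
    then have "D b = diagram ar (length b) {q. rename_atom (embedding b) q \<in> S}"
      using restrict[of "[0..<n]" "embedding b" "length b"] j S
      by (simp add: diagram_proj_diagram[OF j])
    then show ?thesis
      using S by (simp add: Atom_diagram[OF p] Atom_diagram[OF rename_atom_atoms[OF p injections_image[OF j]]])
  qed
  obtain S where S: "\<forall>i<length a. \<forall>k<length a. Eq i k \<in> S \<longleftrightarrow> i = k" "D a = diagram ar (length a) S"
    using diag[OF a] by blast
  have "sat_atom (type_model ar D) a p \<longleftrightarrow> p \<in> S" if p: "p \<in> atoms ar (length a)" for p
  proof (cases p)
    case (Eq i k)
    then have "i < length a" "k < length a" using p by (auto simp: atoms_def)
    then show ?thesis using S(1) a Eq by (simp add: nth_eq_iff_index_eq)
  next
    case (Rel R vs)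
    then have len: "length vs = ar R" and vs: "set vs \<subseteq> {..<length a}"
      using p by (auto simp: atoms_def)
    define xs where "xs = map ((!) a) vs"
    \<comment> \<open>The segment consulted by \<open>type_model\<close>: every entry of
      \<open>xs\<close> is at most the sum, so \<open>Suc\<close> puts all of them below
      \<open>N\<close>, even if \<open>xs\<close> has repetitions.\<close>
    define N where "N = Suc (sum_list xs)"
    \<comment> \<open>A segment long enough to contain both \<open>a\<close> and the consulted
      segment lets the two be compared.\<close>
    obtain n where "set a \<union> set xs \<union> {..<N} \<subseteq> {..<n}"
      using finite_nat_bounded[of "set a \<union> set xs \<union> {..<N}"] by auto
    then have an: "set a \<subseteq> {..<n}" and xn: "set xs \<subseteq> {..<n}" and Nn: "set [0..<N] \<subseteq> {..<n}"
      by (auto simp: atLeast0LessThan)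
    have xN: "x < N" if "x \<in> set xs" for x
      using member_le_sum_list[OF that] by (simp add: N_def)
    then have atom: "Rel R xs \<in> atoms ar (length [0..<N])"
      using len by (auto simp: atoms_def xs_def)
    have eqN: "rename_atom (embedding [0..<N]) (Rel R xs) = Rel R xs"
      using xN by (simp add: embedding_def map_idI)
    have eqa: "rename_atom (embedding a) p = Rel R xs"
      using vs Rel by (auto simp: xs_def embedding_def)
    have "sat_atom (type_model ar D) a p \<longleftrightarrow> Atom (Rel R xs) \<in> conjuncts (D [0..<N])"
      using len Rel by (simp add: type_model_def xs_def N_def)
    also have "\<dots> \<longleftrightarrow> Atom (Rel R xs) \<in> conjuncts (D [0..<n])"
      using rename[OF distinct_upt Nn atom] eqN by simp
    also have "\<dots> \<longleftrightarrow> Atom p \<in> conjuncts (D a)"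
      using rename[OF a an p] eqa by simp
    also have "\<dots> \<longleftrightarrow> p \<in> S"
      unfolding S(2) by (rule Atom_diagram[OF p])
    finally show ?thesis .
  qed
  then show ?thesis unfolding S(2) by (intro diagram_cong) simp
qed

section \<open>The structure on the variables and its Scott process\<close>

theorem theorem6p9:
  fixes ar :: "'r \<Rightarrow> nat"
    and \<delta> :: "'o::wellorder"
    and \<Phi> :: "'o \<Rightarrow> ('r, 'o, 'k) formula set"
  assumes "\<exists>r. ar r = 0"
    and "scott_process ar {..\<delta>} \<Phi>"
    and "\<forall>\<alpha>\<le>\<delta>. \<Phi> \<alpha> \<noteq> {}"
    and "countable (\<Phi> \<delta>)"
  shows "\<exists>M :: ('r, nat) struct. is_struct ar M \<and> countable (univ M) \<and>
           (\<forall>\<alpha>\<le>\<delta>. scott_level ar M \<alpha> = \<Phi> \<alpha>)"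
proof -
  obtain r where ar: "ar r = 0" using assms(1) by blast
  note process = assms(2)
  have ne: "\<Phi> \<delta> \<noteq> {}" using assms(3) by blast
  show ?thesis
  proof (rule types_exist[OF ar process assms(4) ne])
    fix t :: "nat list \<Rightarrow> ('r, 'o, 'k) formula"
    assume slice: "\<And>a. distinct a \<Longrightarrow> t a \<in> slice ar \<Phi> \<delta> (length a)"
      and restrict: "\<And>a m j. distinct a \<Longrightarrow> j \<in> injections m (length a) \<Longrightarrow>
        hproj ar \<delta> m (length a) (t a) j = t (map (\<lambda>i. a ! j i) [0..<m])"
      and occurs: "\<And>n \<phi>. \<phi> \<in> slice ar \<Phi> \<delta> n \<Longrightarrow> \<exists>a. distinct a \<and> length a = n \<and> t a = \<phi>"
      and extends: "\<And>a \<rho> \<alpha>. distinct a \<Longrightarrow> \<rho> \<in> slice ar \<Phi> \<delta> (Suc (length a)) \<Longrightarrow>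
        hproj ar \<delta> (length a) (Suc (length a)) \<rho> (incl (length a)) = t a \<Longrightarrow> \<alpha> < \<delta> \<Longrightarrow>
        \<exists>c. c \<notin> set a \<and> vproj ar \<alpha> \<delta> (t (a @ [c])) = vproj ar \<alpha> \<delta> \<rho>"
    have Psi_t: "Psi ar \<delta> (length a) (t a)" if "distinct a" for a
      using slice[OF that] by (simp add: slice_def)
    define z where "z = (LEAST \<alpha>::'o. True)"
    have z: "is_zero z" by (simp add: is_zero_def z_def Least_le)
    then have "z \<le> \<delta>" by (simp add: is_zero_def)
    \<comment> \<open>Elements are the variables, and atomic truth is given by the projections to
      level zero of the formulas of tuples.\<close>
    define M where "M = type_model ar (\<lambda>a. vproj ar z \<delta> (t a))"
    have univ: "univ M = UNIV" by (simp add: M_def type_model_def)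
    \<comment> \<open>Even for \<alpha> = \<delta> the successor case asks for witnesses only at the
      predecessor, which lies strictly below \<delta>; this is why \<open>extends\<close> is
      enough.\<close>
    have scott: "scott_fm ar M \<alpha> a = vproj ar \<alpha> \<delta> (t a)" if "\<alpha> \<le> \<delta>" "distinct a" for \<alpha> a
      using that
    proof (induction \<alpha> arbitrary: a rule: less_induct)
      case (less \<alpha>)
      note P = Psi_t[OF less.prems(2)]
      note V = Psi_vproj[where ar=ar and r=r, OF ar P less.prems(1)]
      show ?case
      proof (cases \<alpha> rule: ordinal_cases)
        case zero
        then have \<alpha>: "\<alpha> = z" using z by (rule is_zero_unique)
        have *: "diagram_proj m j (vproj ar z \<delta> (t b)) = vproj ar z \<delta> (t (map (\<lambda>i. b ! j i) [0..<m]))"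
          if "distinct b" "j \<in> injections m (length b)" for b m j
          using vproj_hproj[where ar=ar and r=r, OF ar Psi_t[OF that(1)] that(2) \<open>z \<le> \<delta>\<close>]
            restrict[OF that] by (simp add: hproj_zero[OF z])
        show ?thesis
          unfolding \<alpha> scott_fm_zero[OF z] M_def
          by (rule sat_type_model[OF z Psi_vproj[where ar=ar and r=r, OF ar Psi_t \<open>z \<le> \<delta>\<close>] * less.prems(2)])
      next
        case (succ \<beta>)
        note lt = is_succ_less[OF succ]
        have \<beta>: "\<beta> < \<delta>" "\<beta> \<le> \<delta>" using lt less.prems(1) by auto
        have "(\<lambda>c. scott_fm ar M \<beta> (a @ [c])) ` (univ M - set a) =
            (\<lambda>c. vproj ar \<beta> \<delta> (t (a @ [c]))) ` (UNIV - set a)"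
          unfolding univ by (intro image_cong refl less.IH[OF lt \<beta>(2)]) (use less.prems(2) in auto)
        also have "\<dots> = ext ar (vproj ar \<alpha> \<delta> (t a))"
        proof (intro equalityI subsetI)
          fix x assume "x \<in> (\<lambda>c. vproj ar \<beta> \<delta> (t (a @ [c]))) ` (UNIV - set a)"
          then obtain c where c: "c \<notin> set a" "x = vproj ar \<beta> \<delta> (t (a @ [c]))" by auto
          have d: "distinct (a @ [c])" using c(1) less.prems(2) by simp
          have "map (\<lambda>i. (a @ [c]) ! incl (length a) i) [0..<length a] = a"
            by (rule nth_equalityI) (simp_all add: incl_def nth_append)
          then have "hproj ar \<delta> (length a) (Suc (length a)) (t (a @ [c])) (incl (length a)) = t a"
            using restrict[OF d, of "incl (length a)" "length a"] incl_injections[of "length a"] by simp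
          then show "x \<in> ext ar (vproj ar \<alpha> \<delta> (t a))"
            using vproj_ext[OF ar process _ succ less.prems(1), of "t (a @ [c])" "length a"] slice[OF d] c(2)
            by simp
        next
          fix x assume "x \<in> ext ar (vproj ar \<alpha> \<delta> (t a))"
          then obtain \<rho> where \<rho>: "\<rho> \<in> slice ar \<Phi> \<delta> (Suc (length a))"
              "hproj ar \<delta> (length a) (Suc (length a)) \<rho> (incl (length a)) = t a" "x = vproj ar \<beta> \<delta> \<rho>"
            by (rule ext_vproj[OF ar process slice[OF less.prems(2)] succ less.prems(1)])
          \<comment> \<open>The formula \<rho> itself may have no realization over \<open>a\<close>,
            but \<open>x\<close> depends only on its projection to \<beta>, and that is
            realized.\<close>
          then show "x \<in> (\<lambda>c. vproj ar \<beta> \<delta> (t (a @ [c]))) ` (UNIV - set a)"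
            using extends[OF less.prems(2) \<rho>(1,2) \<beta>(1)] by force
        qed
        finally show ?thesis
          using Psi_succE(4)[where ar=ar and r=r, OF ar V succ]
            first_conj_vproj[where ar=ar and r=r, OF ar P succ less.prems(1)]
            less.IH[OF lt \<beta>(2) less.prems(2)]
          by (simp add: scott_fm_succ[OF succ])
      next
        case limit
        have "scott_fm ar M \<beta> a = vproj ar \<beta> \<alpha> (vproj ar \<alpha> \<delta> (t a))" if "\<beta> < \<alpha>" for \<beta>
          using less.IH[OF that _ less.prems(2)]
            vproj_vproj[where ar=ar and r=r, OF ar P _ less.prems(1), of \<beta>] that less.prems(1) by simp
        then have "(\<lambda>\<beta>. scott_fm ar M \<beta> a) ` {..<\<alpha>} = (\<lambda>\<beta>. vproj ar \<beta> \<alpha> (vproj ar \<alpha> \<delta> (t a))) ` {..<\<alpha>}"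
          by (intro image_cong) auto
        then show ?thesis
          unfolding scott_fm_limit[OF limit] using Psi_limitE(1)[where ar=ar and r=r, OF ar V limit] by simp
      qed
    qed
    have "scott_level ar M \<alpha> = \<Phi> \<alpha>" if \<alpha>: "\<alpha> \<le> \<delta>" for \<alpha>
    proof -
      \<comment> \<open>At the top, every formula occurs as that of some tuple;
        \<open>condition_1c\<close> then carries the equality of levels down to \<alpha>.\<close>
      have "\<Phi> \<delta> = t ` {a. distinct a}"
      proof (intro equalityI subsetI)
        fix \<phi> assume "\<phi> \<in> \<Phi> \<delta>"
        then obtain n where "\<phi> \<in> slice ar \<Phi> \<delta> n" using slice_exists[OF ar process] by blast
        then show "\<phi> \<in> t ` {a. distinct a}" using occurs by blast
      next
        fix \<phi> assume "\<phi> \<in> t ` {a. distinct a}"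
        then show "\<phi> \<in> \<Phi> \<delta>" using slice by (auto simp: slice_def)
      qed
      then have "\<Phi> \<alpha> = (\<lambda>a. vproj ar \<alpha> \<delta> (t a)) ` {a. distinct a}"
        using level_vproj[OF ar process \<alpha> order_refl] by (simp add: image_image)
      also have "\<dots> = scott_level ar M \<alpha>"
        unfolding scott_level_def univ using scott[OF \<alpha>] by force
      finally show ?thesis by simp
    qed
    moreover have "is_struct ar M"
      by (auto simp: is_struct_def M_def type_model_def)
    ultimately show ?thesis by (intro exI[of _ M]) simp
  qed
qed

end
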